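(* There is an algorithm that, given a graph $G$ on $n$ vertices, lists all avoidable vertices of $G$ in $O(n^{1+\omega})$ time, where $O(n^{\omega})$ is the time required to multiply two $n\times n$ binary matrices.
   Context: All graphs are finite, simple and undirected. A vertex $v$ of a graph $G$ is avoidable if every induced path on three vertices with middle vertex $v$ is contained in an induced cycle of $G$. *)

theory Defs
  imports Complex_Main "HOL-Library.Landau_Symbols"
begin

text \<open>
  Graphs: a finite simple undirected graph is given by a vertex set \<open>V\<close> and a set \<open>E\<close> of
  two-element subsets of \<open>V\<close>.
\<close>

definition simple_graph :: "'a set \<Rightarrow> 'a set set \<Rightarrow> bool" where
  "simple_graph V E \<longleftrightarrow> finite V \<and> E \<subseteq> {e. e \<subseteq> V \<and> card e = 2}"

definition induced_path :: "'a set \<Rightarrow> 'a set set \<Rightarrow> 'a list \<Rightarrow> bool" where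
  "induced_path V E p \<longleftrightarrow>
     p \<noteq> [] \<and> distinct p \<and> set p \<subseteq> V \<and>
     (\<forall>i<length p. \<forall>j<length p. {p ! i, p ! j} \<in> E \<longleftrightarrow> j = i + 1 \<or> i = j + 1)"

definition induced_cycle :: "'a set \<Rightarrow> 'a set set \<Rightarrow> 'a list \<Rightarrow> bool" where
  "induced_cycle V E c \<longleftrightarrow>
     length c \<ge> 3 \<and> distinct c \<and> set c \<subseteq> V \<and>
     (\<forall>i<length c. \<forall>j<length c. {c ! i, c ! j} \<in> E \<longleftrightarrow>
        j = (i + 1) mod length c \<or> i = (j + 1) mod length c)"

text \<open>
  An induced path and an induced cycle are determined by their vertex sets, so containment of the
  path in the cycle is containment of vertex sets.
\<close>

definition avoidable :: "'a set \<Rightarrow> 'a set set \<Rightarrow> 'a \<Rightarrow> bool" where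
  "avoidable V E v \<longleftrightarrow>
     v \<in> V \<and>
     (\<forall>x y. induced_path V E [x, v, y] \<longrightarrow>
        (\<exists>c. induced_cycle V E c \<and> set [x, v, y] \<subseteq> set c))"

text \<open>
  Model of computation: a word RAM with \<open>w\<close>-bit words, presented as while-programs over finitely
  many word variables and word arrays.  Every operation on words has unit cost (an expression
  costs its number of nodes) and its result is truncated to \<open>w\<close> bits; allocating a zero-initialised
  array costs its length.  Array accesses are bounds-checked: reading outside the bounds yields 0,
  writing outside the bounds has no effect.  The word size is a parameter of the semantics because
  unit-cost arithmetic on unbounded integers would allow a whole matrix row to be packed into a
  single number.
\<close>

type_synonym vname = nat
type_synonym aname = nat

datatype binop = Plus | Minus | Times | Div | Mod | And | Or | Xor | Shl | Shr | Eq | Less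

datatype aexp =
    Const nat
  | Var vname
  | Bin binop aexp aexp
  | Read aname aexp
  | Len aname

datatype com =
    Skip
  | Assign vname aexp
  | Store aname aexp aexp
  | New aname aexp
  | Seq com com
  | Cond aexp com com
  | While aexp com

record state =
  vars :: "vname \<Rightarrow> nat"
  arrs :: "aname \<Rightarrow> nat list"

fun binop_val :: "binop \<Rightarrow> nat \<Rightarrow> nat \<Rightarrow> nat" where
  "binop_val Plus a b = a + b"
| "binop_val Minus a b = a - b"
| "binop_val Times a b = a * b"
| "binop_val Div a b = a div b"
| "binop_val Mod a b = a mod b"
| "binop_val And a b = and a b"
| "binop_val Or a b = or a b"
| "binop_val Xor a b = xor a b"
| "binop_val Shl a b = push_bit b a"
| "binop_val Shr a b = drop_bit b a"
| "binop_val Eq a b = of_bool (a = b)"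
| "binop_val Less a b = of_bool (a < b)"

fun aval :: "nat \<Rightarrow> aexp \<Rightarrow> state \<Rightarrow> nat" where
  "aval w (Const c) s = take_bit w c"
| "aval w (Var x) s = vars s x"
| "aval w (Bin f d e) s = take_bit w (binop_val f (aval w d s) (aval w e s))"
| "aval w (Read a e) s =
     (let i = aval w e s in if i < length (arrs s a) then arrs s a ! i else 0)"
| "aval w (Len a) s = take_bit w (length (arrs s a))"

fun acost :: "aexp \<Rightarrow> nat" where
  "acost (Const c) = 1"
| "acost (Var x) = 1"
| "acost (Bin f d e) = 1 + acost d + acost e"
| "acost (Read a e) = 1 + acost e"
| "acost (Len a) = 1"

text \<open>
  \<open>exec w P s t s'\<close>: with word size \<open>w\<close>, program \<open>P\<close> started in state \<open>s\<close> terminates in state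
  \<open>s'\<close> after exactly \<open>t\<close> time units.
\<close>

inductive exec :: "nat \<Rightarrow> com \<Rightarrow> state \<Rightarrow> nat \<Rightarrow> state \<Rightarrow> bool" for w where
  exec_Skip: "exec w Skip s 1 s"
| exec_Assign:
    "exec w (Assign x e) s (1 + acost e) (s\<lparr>vars := (vars s)(x := aval w e s)\<rparr>)"
| exec_Store:
    "exec w (Store a i e) s (1 + acost i + acost e)
       (s\<lparr>arrs := (arrs s)(a := (arrs s a)[aval w i s := aval w e s])\<rparr>)"
| exec_New:
    "exec w (New a e) s (1 + acost e + aval w e s)
       (s\<lparr>arrs := (arrs s)(a := replicate (aval w e s) 0)\<rparr>)"
| exec_Seq:
    "exec w P s t s' \<Longrightarrow> exec w Q s' u s'' \<Longrightarrow> exec w (Seq P Q) s (t + u) s''"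
| exec_CondTrue:
    "aval w b s \<noteq> 0 \<Longrightarrow> exec w P s t s' \<Longrightarrow> exec w (Cond b P Q) s (1 + acost b + t) s'"
| exec_CondFalse:
    "aval w b s = 0 \<Longrightarrow> exec w Q s t s' \<Longrightarrow> exec w (Cond b P Q) s (1 + acost b + t) s'"
| exec_WhileFalse:
    "aval w b s = 0 \<Longrightarrow> exec w (While b P) s (1 + acost b) s"
| exec_WhileTrue:
    "aval w b s \<noteq> 0 \<Longrightarrow> exec w P s t s' \<Longrightarrow> exec w (While b P) s' u s'' \<Longrightarrow>
     exec w (While b P) s (1 + acost b + t + u) s''"

inductive_cases exec_SkipE: "exec w Skip s t s'"
inductive_cases exec_AssignE: "exec w (Assign x e) s t s'"
inductive_cases exec_StoreE: "exec w (Store a i e) s t s'"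
inductive_cases exec_NewE: "exec w (New a e) s t s'"
inductive_cases exec_SeqE: "exec w (Seq P Q) s t s'"
inductive_cases exec_CondE: "exec w (Cond b P Q) s t s'"
inductive_cases exec_WhileE: "exec w (While b P) s t s'"

lemma exec_deterministic:
  "exec w P s t s' \<Longrightarrow> exec w P s u s'' \<Longrightarrow> t = u \<and> s' = s''"
proof (induction arbitrary: u s'' rule: exec.induct)
  case exec_Skip
  then show ?case by (elim exec_SkipE) simp
next
  case exec_Assign
  then show ?case by (elim exec_AssignE) simp
next
  case exec_Store
  then show ?case by (elim exec_StoreE) simp
next
  case exec_New
  then show ?case by (elim exec_NewE) simp
next
  case exec_Seq
  from exec_Seq.prems show ?case by (rule exec_SeqE) (metis exec_Seq.IH)
next
  case exec_CondTrue
  from exec_CondTrue.prems show ?case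
    by (rule exec_CondE) (metis exec_CondTrue.IH add_Suc plus_1_eq_Suc, use exec_CondTrue.hyps in simp)
next
  case exec_CondFalse
  from exec_CondFalse.prems show ?case
    by (rule exec_CondE) (use exec_CondFalse.hyps in simp, metis exec_CondFalse.IH add_Suc plus_1_eq_Suc)
next
  case exec_WhileFalse
  from exec_WhileFalse.prems show ?case
    by (rule exec_WhileE) (use exec_WhileFalse.hyps in simp_all)
next
  case exec_WhileTrue
  from exec_WhileTrue.prems show ?case
    by (rule exec_WhileE) (use exec_WhileTrue.hyps in simp, metis exec_WhileTrue.IH add_Suc plus_1_eq_Suc)
qed

text \<open>
  \<open>runs_in_time P I sz inp out g\<close>: program \<open>P\<close>, started in \<open>inp x\<close>, halts in a state satisfying
  \<open>out x\<close> for every instance \<open>x \<in> I\<close>, in worst-case time \<open>O(g(sz x))\<close>.  As usual for the word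
  RAM, words have at least \<open>k log (sz x)\<close> bits for a constant \<open>k\<close> depending only on the program;
  the time bound must hold uniformly in the word size, in particular for words of logarithmic
  length.
\<close>

definition runs_in_time ::
  "com \<Rightarrow> 'i set \<Rightarrow> ('i \<Rightarrow> nat) \<Rightarrow> ('i \<Rightarrow> state) \<Rightarrow> ('i \<Rightarrow> state \<Rightarrow> bool) \<Rightarrow> (nat \<Rightarrow> real) \<Rightarrow> bool"
where
  "runs_in_time P I sz inp out g \<longleftrightarrow>
     (\<exists>k. \<exists>T :: nat \<Rightarrow> nat. (\<lambda>n. real (T n)) \<in> O(g) \<and>
        (\<forall>x\<in>I. \<forall>w. (sz x + 2) ^ k \<le> 2 ^ w \<longrightarrow>
           (\<exists>t s'. exec w P (inp x) t s' \<and> t \<le> T (sz x) \<and> out x s')))"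

text \<open>
  Binary \<open>n \<times> n\<close> matrices are stored row by row as 0/1 words.  Programs find \<open>n\<close> in variable 0;
  all variables and arrays not used for the input are initially 0 and empty, respectively.
\<close>

definition encode_matrix :: "nat \<Rightarrow> (nat \<Rightarrow> nat \<Rightarrow> bool) \<Rightarrow> nat list" where
  "encode_matrix n M = map (\<lambda>k. of_bool (M (k div n) (k mod n))) [0..<n * n]"

definition matrix_product :: "nat \<Rightarrow> (nat \<Rightarrow> nat \<Rightarrow> bool) \<Rightarrow> (nat \<Rightarrow> nat \<Rightarrow> bool) \<Rightarrow> nat \<Rightarrow> nat \<Rightarrow> bool" where
  "matrix_product n A B i j \<longleftrightarrow> (\<exists>k<n. A i k \<and> B k j)"

definition multiplies_binary_matrices :: "com \<Rightarrow> (nat \<Rightarrow> real) \<Rightarrow> bool" where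
  "multiplies_binary_matrices P g \<longleftrightarrow>
     runs_in_time P UNIV
       (\<lambda>(n, A, B). n)
       (\<lambda>(n, A, B). \<lparr>vars = (\<lambda>_. 0)(0 := n),
                     arrs = (\<lambda>_. [])(0 := encode_matrix n A, 1 := encode_matrix n B)\<rparr>)
       (\<lambda>(n, A, B) s'. arrs s' 2 = encode_matrix n (matrix_product n A B))
       g"

text \<open>
  The vertices of an input graph on \<open>n\<close> vertices are numbered \<open>0, \<dots>, n - 1\<close>; the input is its
  adjacency matrix.
\<close>

definition lists_avoidable_vertices :: "com \<Rightarrow> (nat \<Rightarrow> real) \<Rightarrow> bool" where
  "lists_avoidable_vertices P g \<longleftrightarrow>
     runs_in_time P {(n, E). simple_graph {..<n} E}
       (\<lambda>(n, E). n)
       (\<lambda>(n, E). \<lparr>vars = (\<lambda>_. 0)(0 := n),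
                  arrs = (\<lambda>_. [])(0 := encode_matrix n (\<lambda>i j. {i, j} \<in> E))\<rparr>)
       (\<lambda>(n, E) s'. distinct (arrs s' 1) \<and> set (arrs s' 1) = {v. avoidable {..<n} E v})
       g"

end

theory Submission
  imports Defs
begin

text \<open>
  For nonadjacent neighbours \<open>x\<close>, \<open>y\<close> of \<open>v\<close>, a shortest path from \<open>x\<close> to \<open>y\<close> with interior outside
  the closed neighbourhood \<open>N[v]\<close> closes up with \<open>v\<close> to an induced cycle, and every induced cycle
  through \<open>x\<close>, \<open>v\<close>, \<open>y\<close> arises from such a path.  So \<open>v\<close> is avoidable iff any two such \<open>x\<close>, \<open>y\<close> see
  a common component of \<open>G - N[v]\<close>.  If \<open>B\<close> is the incidence matrix between \<open>N(v)\<close> and these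
  components, this can be read off the Boolean product of \<open>B\<close> with its transpose: one multiplication
  per vertex.  The components are found in time \<open>O(n\<^sup>2)\<close> by inserting the vertices one at a time and
  giving all components adjacent to the new vertex \<open>u\<close> the label \<open>u\<close>.  Since a program that outputs an
  \<open>n \<times> n\<close> matrix has to allocate it, \<open>\<omega> \<ge> 2\<close>, and the \<open>O(n\<^sup>2)\<close> steps per vertex are dominated by
  the multiplication.
\<close>

section \<open>Avoidability in terms of the components outside a closed neighbourhood\<close>

definition outside :: "(nat \<Rightarrow> nat \<Rightarrow> bool) \<Rightarrow> nat \<Rightarrow> nat \<Rightarrow> bool" where
  "outside a v u \<longleftrightarrow> u \<noteq> v \<and> \<not> a v u"

text \<open>Adjacency of \<open>G - N[v]\<close> on the original vertex numbers; the vertices of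
  \<open>N[v]\<close> stay as isolated points, so nothing has to be renumbered.\<close>

definition outer_adj :: "(nat \<Rightarrow> nat \<Rightarrow> bool) \<Rightarrow> nat \<Rightarrow> nat \<Rightarrow> nat \<Rightarrow> bool" where
  "outer_adj a v x y \<longleftrightarrow> outside a v x \<and> outside a v y \<and> a x y"

definition below_rel :: "(nat \<Rightarrow> nat \<Rightarrow> bool) \<Rightarrow> nat \<Rightarrow> (nat \<times> nat) set" where
  "below_rel H n = {(x, y). x < n \<and> y < n \<and> H x y}"

text \<open>\<open>label H u\<close> describes the graph on the vertices below \<open>u\<close>.
  Inserting \<open>u\<close> merges all components adjacent to it, so for symmetric \<open>H\<close>
  a component is named by its largest vertex. Numbers from \<open>u\<close> on still carry the
  placeholder 0, which may also be a genuine label; the guard \<open>x < u\<close> keeps them from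
  being relabelled.\<close>

primrec label :: "(nat \<Rightarrow> nat \<Rightarrow> bool) \<Rightarrow> nat \<Rightarrow> nat \<Rightarrow> nat" where
  "label H 0 = (\<lambda>_. 0)"
| "label H (Suc u) =
     (\<lambda>x. if x = u \<or> (x < u \<and> (\<exists>y<u. H u y \<and> label H u y = label H u x)) then u
          else label H u x)"

lemma label_less: "x < u \<Longrightarrow> label H u x < u"
  by (induction u) (auto simp: less_Suc_eq)

text \<open>Induction on the inserted vertex: a label other than the newest one is inherited from
  the previous stage, and all vertices with the newest label are joined through the new
  vertex.\<close>

lemma label_eq_imp_connected:
  assumes sym: "\<And>x y. H x y \<Longrightarrow> H y x"
  shows "x < u \<Longrightarrow> y < u \<Longrightarrow> label H u x = label H u y \<Longrightarrow> (x, y) \<in> (below_rel H u)\<^sup>*"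
proof (induction u arbitrary: x y)
  case (Suc u)
  let ?R = "(below_rel H (Suc u))\<^sup>*"
  have mono: "(below_rel H u)\<^sup>* \<subseteq> ?R"
    by (rule rtrancl_mono) (auto simp: below_rel_def)
  have "sym (below_rel H (Suc u))"
    using sym by (auto simp: sym_def below_rel_def)
  then have R_sym: "(p, q) \<in> ?R \<Longrightarrow> (q, p) \<in> ?R" for p q
    by (blast dest: sym_rtrancl symD)
  have to_u: "(z, u) \<in> ?R" if "z < Suc u" "label H (Suc u) z = u" for z
  proof (cases "z = u")
    case False
    \<comment> \<open>By \<open>label_less\<close> no old label equals \<open>u\<close>, so
      \<open>z\<close> was relabelled because its old component contains a neighbour
      \<open>y'\<close> of \<open>u\<close>.\<close>
    with that label_less[of z u H] obtain y' where
      y': "y' < u" "H u y'" "label H u y' = label H u z" and z: "z < u"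
      by (auto split: if_splits)
    have "(z, y') \<in> ?R"
      using Suc.IH[OF z y'(1)] y'(3) mono by auto
    moreover have "(y', u) \<in> below_rel H (Suc u)"
      using y' sym by (auto simp: below_rel_def)
    ultimately show ?thesis by (rule rtrancl_into_rtrancl)
  qed auto
  show ?case
  proof (cases "label H (Suc u) x = u")
    case True
    then show ?thesis
      using Suc.prems to_u[of x] R_sym[OF to_u[of y]] by (auto intro: rtrancl_trans)
  next
    case False
    then have "label H (Suc u) y \<noteq> u" using Suc.prems by simp
    with False Suc.prems have "x < u" "y < u" "label H u x = label H u y"
      by (auto split: if_splits simp: less_Suc_eq)
    then show ?thesis using Suc.IH mono by blast
  qed
qed simp

text \<open>An edge at the newest vertex puts its other end into a component that is relabelled to
  this vertex; the ends of an older edge share a label and are relabelled together.\<close>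

lemma edge_imp_label_eq:
  assumes sym: "\<And>x y. H x y \<Longrightarrow> H y x"
  shows "x < u \<Longrightarrow> y < u \<Longrightarrow> H x y \<Longrightarrow> label H u x = label H u y"
proof (induction u arbitrary: x y)
  case (Suc u)
  consider "x = u" "y = u" | "x = u" "y < u" | "x < u" "y = u" | "x < u" "y < u"
    using Suc.prems by linarith
  then show ?case
  proof cases
    case 2
    then show ?thesis using Suc.prems by auto
  next
    case 3
    then show ?thesis using sym[OF Suc.prems(3)] by auto
  next
    case 4
    then show ?thesis using Suc.IH[of x y] Suc.prems by auto
  qed simp
qed simp

lemma label_eq_iff_connected:
  assumes sym: "\<And>x y. H x y \<Longrightarrow> H y x" and "x < n" "y < n"
  shows "label H n x = label H n y \<longleftrightarrow> (x, y) \<in> (below_rel H n)\<^sup>*"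
proof
  assume "(x, y) \<in> (below_rel H n)\<^sup>*"
  then show "label H n x = label H n y"
  proof induction
    case (step y z)
    then have "label H n y = label H n z"
      by (intro edge_imp_label_eq[OF sym]) (auto simp: below_rel_def)
    with step show ?case by simp
  qed simp
qed (use label_eq_imp_connected[of H x n y] assms in blast)

section \<open>Shortest walks with prescribed interior\<close>

lemma rtrancl_iff_walk:
  "(x, y) \<in> R\<^sup>* \<longleftrightarrow> (\<exists>m f. f 0 = x \<and> f m = y \<and> (\<forall>i<m. (f i, f (Suc i)) \<in> R))"
  unfolding rtrancl_power relpow_fun_conv ..

text \<open>\<open>S\<close> constrains only the interior, since the ends will be neighbours of
  \<open>v\<close> and thus lie outside \<open>G - N[v]\<close>. Repetitions are allowed; the
  absence of chords will exclude them.\<close>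

definition inner_walk ::
  "(nat \<Rightarrow> nat \<Rightarrow> bool) \<Rightarrow> nat set \<Rightarrow> nat \<Rightarrow> nat \<Rightarrow> nat \<Rightarrow> (nat \<Rightarrow> nat) \<Rightarrow> bool" where
  "inner_walk a S x y m f \<longleftrightarrow>
     f 0 = x \<and> f m = y \<and> (\<forall>i. 0 < i \<and> i < m \<longrightarrow> f i \<in> S) \<and> (\<forall>i<m. a (f i) (f (Suc i)))"

lemma inner_walk_shortcut:
  assumes w: "inner_walk a S x y m f" and "i + 1 < j" "j \<le> m" and ij: "a (f i) (f j)"
  shows "\<exists>m' g. m' < m \<and> inner_walk a S x y m' g"
proof (intro exI conjI)
  \<comment> \<open>The \<open>d\<close> positions strictly between \<open>i\<close> and
    \<open>j\<close> are cut out, and the later ones move down by \<open>d\<close>.\<close>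
  define d where "d = j - i - 1"
  define g where "g k = (if k \<le> i then f k else f (k + d))" for k
  have d: "d > 0" "d + i + 1 = j" using assms by (auto simp: d_def)
  show "m - d < m" using assms d by simp
  have "a (g k) (g (Suc k))" if "k < m - d" for k
  proof -
    consider "k < i" | "k = i" | "k > i" by linarith
    then show ?thesis
    proof cases
      case 2
      then show ?thesis using ij d by (simp add: g_def add.commute)
    qed (use that w d assms in \<open>auto simp: g_def inner_walk_def\<close>)
  qed
  then show "inner_walk a S x y (m - d) g"
    using w d assms by (auto simp: inner_walk_def g_def)
qed

text \<open>In a walk of least length any chord would give a shortcut.\<close>

lemma shortest_inner_walk:
  assumes "inner_walk a S x y m f"
  shows "\<exists>m f. inner_walk a S x y m f \<and> (\<forall>i j. i + 1 < j \<and> j \<le> m \<longrightarrow> \<not> a (f i) (f j))"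
proof -
  define m where "m = (LEAST m. \<exists>f. inner_walk a S x y m f)"
  have "\<exists>f. inner_walk a S x y m f"
    unfolding m_def by (rule LeastI_ex) (use assms in blast)
  then obtain f where f: "inner_walk a S x y m f" by blast
  have "\<not> a (f i) (f j)" if "i + 1 < j" "j \<le> m" for i j
    using inner_walk_shortcut[OF f that] not_less_Least[of _ "\<lambda>m. \<exists>f. inner_walk a S x y m f"]
    unfolding m_def by blast
  with f show ?thesis by blast
qed

section \<open>Induced cycles through a vertex and two of its neighbours\<close>

lemma simple_graph_adj:
  assumes "simple_graph {..<n} E" "{x, y} \<in> E"
  shows "x < n" "y < n" "x \<noteq> y"
proof -
  have "{x, y} \<subseteq> {..<n} \<and> card {x, y} = 2"
    using assms unfolding simple_graph_def by blast
  then show "x < n" "y < n" "x \<noteq> y" by auto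
qed

lemma induced_path_three_iff:
  assumes G: "simple_graph {..<n} E"
  shows "induced_path {..<n} E [x, v, y] \<longleftrightarrow>
    {v, x} \<in> E \<and> {v, y} \<in> E \<and> x \<noteq> y \<and> {x, y} \<notin> E"
proof
  assume "induced_path {..<n} E [x, v, y]"
  then have d: "x \<noteq> y" and *: "\<And>i j. i < 3 \<Longrightarrow> j < 3 \<Longrightarrow>
      {[x, v, y] ! i, [x, v, y] ! j} \<in> E \<longleftrightarrow> j = i + 1 \<or> i = j + 1"
    by (auto simp: induced_path_def)
  show "{v, x} \<in> E \<and> {v, y} \<in> E \<and> x \<noteq> y \<and> {x, y} \<notin> E"
    using *[of 1 0] *[of 1 2] *[of 0 2] d by simp
next
  assume *: "{v, x} \<in> E \<and> {v, y} \<in> E \<and> x \<noteq> y \<and> {x, y} \<notin> E"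
  \<comment> \<open>Equal indices in \<open>induced_path\<close> ask about
    \<open>{z, z} = {z}\<close>, which has one element only and is no edge.\<close>
  have "{z} \<notin> E" for z using simple_graph_adj(3)[OF G, of z z] by auto
  then show "induced_path {..<n} E [x, v, y]"
    using * simple_graph_adj[OF G, of v x] simple_graph_adj[OF G, of v y]
    by (auto simp: induced_path_def less_Suc_eq insert_commute)
qed

text \<open>The ends of the walk are neighbours of \<open>v\<close> and its interior avoids
  \<open>N[v]\<close>, so prepending \<open>v\<close> adds exactly two edges; all other adjacencies
  are controlled by the absence of chords.\<close>

lemma induced_cycle_of_inner_walk:
  assumes G: "simple_graph {..<n} E"
    and E: "{v, x} \<in> E" "{v, y} \<in> E" "x \<noteq> y" "{x, y} \<notin> E"
    and w: "inner_walk (\<lambda>i j. {i, j} \<in> E) {u. u < n \<and> outside (\<lambda>i j. {i, j} \<in> E) v u} x y m f"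
    and chordless: "\<And>i j. i + 1 < j \<Longrightarrow> j \<le> m \<Longrightarrow> {f i, f j} \<notin> E"
  shows "induced_cycle {..<n} E (v # map f [0..<Suc m])"
proof -
  have ends: "f 0 = x" "f m = y" using w by (auto simp: inner_walk_def)
  have inner: "f i < n" "f i \<noteq> v" "{v, f i} \<notin> E" if "0 < i" "i < m" for i
    using w that by (auto simp: inner_walk_def outside_def)
  have step: "{f i, f (Suc i)} \<in> E" if "i < m" for i
    using w that by (auto simp: inner_walk_def)
  have loop: "{z} \<notin> E" for z using simple_graph_adj(3)[OF G, of z z] by auto
  \<comment> \<open>\<open>m = 0\<close> would force \<open>x = y\<close>, and \<open>m = 1\<close>
    would make \<open>x\<close> and \<open>y\<close> adjacent.\<close>
  have m: "m \<ge> 2"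
    using ends E step[of 0] by (cases m; cases "m - 1") auto
  have v_adj: "{v, f i} \<in> E \<longleftrightarrow> i = 0 \<or> i = m" if "i \<le> m" for i
    using inner(3)[of i] ends E that by (cases "i = 0 \<or> i = m") auto
  have v_neq: "f i \<noteq> v" if "i \<le> m" for i
    using inner(2)[of i] ends E simple_graph_adj(3)[OF G] that by (cases "i = 0 \<or> i = m") auto
  have less: "f i < n" if "i \<le> m" for i
    using inner(1)[of i] ends E simple_graph_adj[OF G] that by (cases "i = 0 \<or> i = m") auto
  \<comment> \<open>If \<open>f i = f j\<close> with \<open>j < m\<close>, the edge from
    \<open>f j\<close> to \<open>f (Suc j)\<close> would be a chord starting at position
    \<open>i\<close>. For \<open>j = m\<close>, adjacency to \<open>v\<close> separates the two, or
    \<open>x \<noteq> y\<close> when \<open>i = 0\<close>.\<close>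
  have neq: "f i \<noteq> f j" if "i < j" "j \<le> m" for i j
  proof (cases "j = m")
    case True
    then show ?thesis
      using v_adj[of i] v_adj[of m] that ends E by (cases "i = 0") auto
  next
    case False
    then have "{f j, f (Suc j)} \<in> E" using step that by simp
    moreover have "{f i, f (Suc j)} \<notin> E" using chordless that False by simp
    ultimately show ?thesis by auto
  qed
  have inj: "inj_on f {0..<Suc m}"
    by (rule linorder_inj_onI) (use neq in auto)
  have adj_less: "{f i, f j} \<in> E \<longleftrightarrow> j = Suc i" if "i < j" "j \<le> m" for i j
    using chordless[of i j] step[of i] that by (cases "j = Suc i") auto
  have adj: "{f i, f j} \<in> E \<longleftrightarrow> j = Suc i \<or> i = Suc j" if "i \<le> m" "j \<le> m" for i j
    using adj_less[of i j] adj_less[of j i] that loop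
    by (cases i j rule: linorder_cases) (auto simp: insert_commute)
  show ?thesis
    unfolding induced_cycle_def
  proof (intro conjI allI impI)
    show "3 \<le> length (v # map f [0..<Suc m])" using m by simp
    show "distinct (v # map f [0..<Suc m])"
    proof -
      have "v \<notin> f ` {0..<Suc m}" using v_neq by (metis atLeastLessThan_iff imageE less_Suc_eq_le)
      then show ?thesis using inj by (auto simp: distinct_map simp del: upt_Suc)
    qed
    show "set (v # map f [0..<Suc m]) \<subseteq> {..<n}"
      using less simple_graph_adj[OF G E(1)] by (auto simp del: upt_Suc)
  next
    fix i j
    assume ij: "i < length (v # map f [0..<Suc m])" "j < length (v # map f [0..<Suc m])"
    \<comment> \<open>Walk position \<open>k\<close> is index \<open>k + 1\<close> of the cycle; the
      successor of the last one wraps around to index 0, where \<open>v\<close> stands.\<close>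
    have mod_Suc_Suc: "(Suc k + 1) mod (m + 2) = (if k = m then 0 else k + 2)" if "k \<le> m" for k
      using that by simp
    have nth: "(v # map f [0..<Suc m]) ! Suc k = f k" if "k \<le> m" for k
      using that by (simp del: upt_Suc)
    have len: "length (v # map f [0..<Suc m]) = m + 2" by simp
    show "{(v # map f [0..<Suc m]) ! i, (v # map f [0..<Suc m]) ! j} \<in> E \<longleftrightarrow>
      j = (i + 1) mod length (v # map f [0..<Suc m]) \<or>
      i = (j + 1) mod length (v # map f [0..<Suc m])"
    proof (cases i)
      case 0
      show ?thesis
      proof (cases j)
        case 0
        then show ?thesis using \<open>i = 0\<close> loop by simp
      next
        case (Suc l)
        then have l: "l \<le> m" using ij by simp
        show ?thesis
          unfolding len unfolding \<open>i = 0\<close> Suc nth[OF l] mod_Suc_Suc[OF l]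
          using v_adj[OF l] by auto
      qed
    next
      case (Suc k)
      then have k: "k \<le> m" using ij by simp
      show ?thesis
      proof (cases j)
        case 0
        show ?thesis
          unfolding len unfolding Suc 0 nth[OF k] mod_Suc_Suc[OF k]
          using v_adj[OF k] by (auto simp: insert_commute)
      next
        case j: (Suc l)
        then have l: "l \<le> m" using ij by simp
        show ?thesis
          unfolding len unfolding Suc j nth[OF k] nth[OF l] mod_Suc_Suc[OF k] mod_Suc_Suc[OF l]
          using adj[OF k l] k l by auto
      qed
    qed
  qed
qed

text \<open>Going around the cycle from \<open>v\<close>, its neighbours \<open>x\<close> and
  \<open>y\<close> are met first and last, in some order; what lies between them is a path in
  \<open>G - N[v]\<close>.\<close>

lemma induced_cycle_imp_connected:
  assumes G: "simple_graph {..<n} E"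
    and E: "{v, x} \<in> E" "{v, y} \<in> E" "x \<noteq> y" "{x, y} \<notin> E"
    and c: "induced_cycle {..<n} E c" "{x, v, y} \<subseteq> set c"
  defines "a \<equiv> \<lambda>i j. {i, j} \<in> E"
  shows "\<exists>u u'. u < n \<and> u' < n \<and> outside a v u \<and> outside a v u' \<and> a x u \<and> a y u' \<and>
    (u, u') \<in> (below_rel (outer_adj a v) n)\<^sup>*"
proof -
  define L where "L = length c"
  have L: "L \<ge> 3" using c by (auto simp: induced_cycle_def L_def)
  obtain p where p: "p < L" "c ! p = v"
    using c(2) by (auto simp: in_set_conv_nth L_def)
  \<comment> \<open>The cycle rotated so that it starts at \<open>v\<close>.\<close>
  define d where "d k = c ! ((p + k) mod L)" for k
  have d0: "d 0 = v" using p by (simp add: d_def)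
  \<comment> \<open>The index sums reduced with this fact stay below \<open>2 * L\<close>, so
    reduction modulo \<open>L\<close> subtracts \<open>L\<close> at most once.\<close>
  have wrap: "k mod L = (if k < L then k else k - L)" if "k < 2 * L" for k
    using that by (simp add: le_mod_geq)
  have d_neq: "d i \<noteq> v" if "0 < i" "i < L" for i
  proof -
    have "(p + i) mod L \<noteq> p" using wrap[of "p + i"] p that by auto
    moreover have "(p + i) mod L < L" using L by simp
    ultimately show ?thesis
      using c(1) p nth_eq_iff_index_eq[of c] by (auto simp: d_def L_def induced_cycle_def)
  qed
  have d_adj: "a (d i) (d j) \<longleftrightarrow> j = (i + 1) mod L \<or> i = (j + 1) mod L" if "i < L" "j < L" for i j
  proof -
    have shift: "(p + j) mod L = ((p + i) mod L + 1) mod L \<longleftrightarrow> j = (i + 1) mod L"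
      if "i < L" "j < L" for i j
      using that p wrap[of "p + j"] wrap[of "p + i"] wrap[of "(p + i) mod L + 1"] wrap[of "i + 1"]
      by (auto split: if_splits)
    have "(p + i) mod L < length c" "(p + j) mod L < length c"
      using L unfolding L_def by (auto intro!: mod_less_divisor)
    then have "a (d i) (d j) \<longleftrightarrow>
      (p + j) mod L = ((p + i) mod L + 1) mod L \<or> (p + i) mod L = ((p + j) mod L + 1) mod L"
      using c(1) unfolding induced_cycle_def a_def d_def L_def by blast
    then show ?thesis using shift that by simp
  qed
  have d_less: "d i < n" for i
  proof -
    have "d i \<in> set c" unfolding d_def using L unfolding L_def by (auto intro!: nth_mem mod_less_divisor)
    then show ?thesis using c(1) by (auto simp: induced_cycle_def)
  qed
  have d_surj: "\<exists>i<L. d i = z" if z: "z \<in> set c" for z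
  proof -
    obtain q where q: "q < L" "c ! q = z" using z by (auto simp: in_set_conv_nth L_def)
    \<comment> \<open>Adding \<open>L - p\<close> inverts the rotation and avoids a truncated
      subtraction \<open>q - p\<close>.\<close>
    have "d ((q + (L - p)) mod L) = z"
      using p q by (simp add: d_def mod_simps)
    then show ?thesis using L by (intro exI[of _ "(q + (L - p)) mod L"]) auto
  qed
  have nbr: "i = 1 \<or> i = L - 1" if "a v (d i)" "i < L" for i
    using that d_adj[of 0 i] d0 L by (auto simp: mod_Suc split: if_splits)
  obtain i j where ij: "i < L" "d i = x" "j < L" "d j = y" using d_surj c(2) by (metis insert_subset)
  have "i = 1 \<or> i = L - 1" "j = 1 \<or> j = L - 1" "i \<noteq> j"
    using ij E nbr by (auto simp: a_def)
  \<comment> \<open>In a triangle the positions 1 and 2 are adjacent, but they hold \<open>x\<close>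
    and \<open>y\<close>.\<close>
  have L4: "L \<ge> 4"
  proof (rule ccontr)
    assume "\<not> L \<ge> 4"
    then have "L = 3" using L by simp
    then have "{x, y} \<in> E"
      using d_adj[of 1 2] ij \<open>i = 1 \<or> i = L - 1\<close> \<open>j = 1 \<or> j = L - 1\<close> \<open>i \<noteq> j\<close>
      by (auto simp: a_def insert_commute)
    then show False using E by simp
  qed
  have out: "outside a v (d k)" if "2 \<le> k" "k \<le> L - 2" for k
  proof -
    have "k \<noteq> 1" "k \<noteq> L - 1" "k < L" using that L4 by auto
    then have "\<not> a v (d k)" using nbr by blast
    moreover have "d k \<noteq> v" using d_neq[of k] that L4 by simp
    ultimately show ?thesis by (simp add: outside_def)
  qed
  \<comment> \<open>Positions 2 to \<open>L - 2\<close> form the path; for \<open>L = 4\<close> it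
    is a single vertex and the walk has length 0.\<close>
  have conn: "(d 2, d (L - 2)) \<in> (below_rel (outer_adj a v) n)\<^sup>*"
  proof -
    have "(d (2 + k), d (2 + Suc k)) \<in> below_rel (outer_adj a v) n" if "k < L - 4" for k
      using that out[of "2 + k"] out[of "2 + Suc k"] d_adj[of "2 + k" "2 + Suc k"] d_less
      by (auto simp: below_rel_def outer_adj_def)
    moreover have "2 + (L - 4) = L - 2" using L4 by simp
    ultimately show ?thesis
      unfolding rtrancl_iff_walk
      by (intro exI[of _ "L - 4"] exI[of _ "\<lambda>k. d (2 + k)"]) auto
  qed
  have sym: "sym (below_rel (outer_adj a v) n)"
    by (auto simp: sym_def below_rel_def outer_adj_def a_def insert_commute)
  have e: "a (d 1) (d 2)" "a (d (L - 1)) (d (L - 2))"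
    using d_adj[of 1 2] d_adj[of "L - 1" "L - 2"] L4 by auto
  consider "i = 1" "j = L - 1" | "i = L - 1" "j = 1"
    using \<open>i = 1 \<or> i = L - 1\<close> \<open>j = 1 \<or> j = L - 1\<close> \<open>i \<noteq> j\<close> by blast
  then show ?thesis
  proof cases
    case 1
    then show ?thesis
      using ij e conn out[of 2] out[of "L - 2"] d_less L4 by (intro exI[of _ "d 2"] exI[of _ "d (L - 2)"]) auto
  next
    case 2
    then show ?thesis
      using ij e symD[OF sym_rtrancl[OF sym] conn] out[of 2] out[of "L - 2"] d_less L4
      by (intro exI[of _ "d (L - 2)"] exI[of _ "d 2"]) auto
  qed
qed

text \<open>The incidence matrix \<open>B\<close>: \<open>x\<close> has a neighbour in the component
  called \<open>c\<close>. Rows are indexed by all vertices and columns by all possible labels; rows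
  outside \<open>N(v)\<close> are zero, which gives the format \<open>n\<close> by
  \<open>n\<close>.\<close>

definition sees :: "nat \<Rightarrow> (nat \<Rightarrow> nat \<Rightarrow> bool) \<Rightarrow> nat \<Rightarrow> nat \<Rightarrow> nat \<Rightarrow> bool" where
  "sees n a v x c \<longleftrightarrow>
     (\<exists>u<n. a v x \<and> outside a v u \<and> a x u \<and> label (outer_adj a v) n u = c)"

text \<open>The inner existential is the entry at \<open>x\<close>, \<open>y\<close> of the Boolean
  product of \<open>sees n a v\<close> with its transpose; \<open>label_less\<close> provides the
  bound on \<open>c\<close>.\<close>

lemma avoidable_iff_sees:
  assumes G: "simple_graph {..<n} E" and v: "v < n"
  defines "a \<equiv> \<lambda>i j. {i, j} \<in> E"
  shows "avoidable {..<n} E v \<longleftrightarrow>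
    (\<forall>x<n. \<forall>y<n. a v x \<and> a v y \<and> x \<noteq> y \<and> \<not> a x y \<longrightarrow>
       (\<exists>c<n. sees n a v x c \<and> sees n a v y c))"
proof -
  let ?R = "(below_rel (outer_adj a v) n)\<^sup>*"
  have sym: "outer_adj a v x y \<Longrightarrow> outer_adj a v y x" for x y
    by (auto simp: outer_adj_def a_def insert_commute)
  have common: "(\<exists>c<n. sees n a v x c \<and> sees n a v y c) \<longleftrightarrow>
    (\<exists>u u'. u < n \<and> u' < n \<and> outside a v u \<and> outside a v u' \<and> a x u \<and> a y u' \<and> (u, u') \<in> ?R)"
    if "a v x" "a v y" for x y
  proof -
    let ?l = "label (outer_adj a v) n"
    have l_eq: "?l u = ?l u' \<longleftrightarrow> (u, u') \<in> ?R" if "u < n" "u' < n" for u u'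
      by (rule label_eq_iff_connected[OF sym that])
    show ?thesis
    proof
      assume "\<exists>c<n. sees n a v x c \<and> sees n a v y c"
      then obtain u u' where u: "u < n" "u' < n" "outside a v u" "outside a v u'" "a x u" "a y u'"
        "?l u = ?l u'" by (auto simp: sees_def)
      then show "\<exists>u u'. u < n \<and> u' < n \<and> outside a v u \<and> outside a v u' \<and> a x u \<and> a y u' \<and> (u, u') \<in> ?R"
        using l_eq[OF u(1,2)] by blast
    next
      assume "\<exists>u u'. u < n \<and> u' < n \<and> outside a v u \<and> outside a v u' \<and> a x u \<and> a y u' \<and> (u, u') \<in> ?R"
      then obtain u u' where u: "u < n" "u' < n" "outside a v u" "outside a v u'" "a x u" "a y u'"
        "(u, u') \<in> ?R" by blast
      then have "sees n a v x (?l u)" "sees n a v y (?l u)"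
        using that l_eq[OF u(1,2)] by (auto simp: sees_def)
      then show "\<exists>c<n. sees n a v x c \<and> sees n a v y c"
        using label_less[OF u(1)] by blast
    qed
  qed
  have main: "(\<exists>c. induced_cycle {..<n} E c \<and> set [x, v, y] \<subseteq> set c) \<longleftrightarrow>
      (\<exists>c<n. sees n a v x c \<and> sees n a v y c)"
    if e: "a v x" "a v y" "x \<noteq> y" "\<not> a x y" for x y
  proof
    assume "\<exists>c. induced_cycle {..<n} E c \<and> set [x, v, y] \<subseteq> set c"
    then obtain c where c: "induced_cycle {..<n} E c" "{x, v, y} \<subseteq> set c" by auto
    show "\<exists>c<n. sees n a v x c \<and> sees n a v y c"
      unfolding common[OF e(1,2)] unfolding a_def
      by (rule induced_cycle_imp_connected[OF G _ _ _ _ c]) (use e in \<open>auto simp: a_def\<close>)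
  next
    assume "\<exists>c<n. sees n a v x c \<and> sees n a v y c"
    then obtain u u' where u: "u < n" "u' < n" "outside a v u" "outside a v u'" "a x u" "a y u'"
      and "(u, u') \<in> ?R"
      using common[OF e(1,2)] by blast
    then obtain m f where f: "f 0 = u" "f m = u'"
      "\<And>i. i < m \<Longrightarrow> (f i, f (Suc i)) \<in> below_rel (outer_adj a v) n"
      using rtrancl_iff_walk[of u u' "below_rel (outer_adj a v) n"] by blast
    \<comment> \<open>The connecting walk is extended by \<open>x\<close> in front and
      \<open>y\<close> at the end; a shortest walk then replaces it and closes up with
      \<open>v\<close>.\<close>
    define g where "g i = (if i = 0 then x else if i = m + 2 then y else f (i - 1))" for i
    have fS: "f i < n \<and> outside a v (f i)" if "i \<le> m" for i
      using f(3)[of i] f(2) u that by (cases "i = m") (auto simp: below_rel_def outer_adj_def)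
    have "a (g i) (g (Suc i))" if i: "i < m + 2" for i
    proof -
      consider "i = 0" | "i = m + 1" | "0 < i" "i - 1 < m" using i by linarith
      then show ?thesis
      proof cases
        case 3
        then show ?thesis using f(3)[of "i - 1"]
          by (auto simp: g_def below_rel_def outer_adj_def)
      qed (use f u in \<open>auto simp: g_def a_def insert_commute\<close>)
    qed
    then have "inner_walk a {u. u < n \<and> outside a v u} x y (m + 2) g"
      using fS by (auto simp: inner_walk_def g_def)
    then obtain m f where w: "inner_walk a {u. u < n \<and> outside a v u} x y m f"
      and chordless: "\<forall>i j. i + 1 < j \<and> j \<le> m \<longrightarrow> \<not> a (f i) (f j)"
      by (blast dest: shortest_inner_walk)
    have "induced_cycle {..<n} E (v # map f [0..<Suc m])"
      by (rule induced_cycle_of_inner_walk[OF G _ _ _ _ w[unfolded a_def]])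
        (use e chordless in \<open>auto simp: a_def\<close>)
    moreover have "{x, v, y} \<subseteq> set (v # map f [0..<Suc m])"
    proof -
      have "f 0 \<in> f ` {0..<Suc m}" "f m \<in> f ` {0..<Suc m}" by auto
      then show ?thesis using w by (auto simp: inner_walk_def simp del: upt_Suc)
    qed
    ultimately show "\<exists>c. induced_cycle {..<n} E c \<and> set [x, v, y] \<subseteq> set c" by auto
  qed
  have "avoidable {..<n} E v \<longleftrightarrow>
    (\<forall>x y. a v x \<and> a v y \<and> x \<noteq> y \<and> \<not> a x y \<longrightarrow>
       (\<exists>c. induced_cycle {..<n} E c \<and> set [x, v, y] \<subseteq> set c))"
    unfolding avoidable_def induced_path_three_iff[OF G] a_def using v by simp
  also have "\<dots> \<longleftrightarrow> (\<forall>x y. a v x \<and> a v y \<and> x \<noteq> y \<and> \<not> a x y \<longrightarrow>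
       (\<exists>c<n. sees n a v x c \<and> sees n a v y c))"
    using main by blast
  also have "\<dots> \<longleftrightarrow> (\<forall>x<n. \<forall>y<n. a v x \<and> a v y \<and> x \<noteq> y \<and> \<not> a x y \<longrightarrow>
       (\<exists>c<n. sees n a v x c \<and> sees n a v y c))"
    using simple_graph_adj(2)[OF G, of v] unfolding a_def by blast
  finally show ?thesis .
qed

section \<open>A weakest-precondition calculus with time\<close>

text \<open>Total correctness with a postcondition that also receives the running time. As
  \<open>exec\<close> is deterministic, one terminating run is the only run.\<close>

definition wp :: "nat \<Rightarrow> com \<Rightarrow> state \<Rightarrow> (nat \<Rightarrow> state \<Rightarrow> bool) \<Rightarrow> bool" where
  "wp w P s Q \<longleftrightarrow> (\<exists>t s'. exec w P s t s' \<and> Q t s')"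

lemma wpI: "exec w P s t s' \<Longrightarrow> Q t s' \<Longrightarrow> wp w P s Q"
  by (auto simp: wp_def)

lemma wp_mono: "wp w P s Q \<Longrightarrow> (\<And>t s'. Q t s' \<Longrightarrow> Q' t s') \<Longrightarrow> wp w P s Q'"
  by (auto simp: wp_def)

lemma wp_Skip: "wp w Skip s Q \<longleftrightarrow> Q 1 s"
  unfolding wp_def by (metis exec_Skip exec_SkipE)

lemma wp_Assign:
  "wp w (Assign x e) s Q \<longleftrightarrow> Q (1 + acost e) (s\<lparr>vars := (vars s)(x := aval w e s)\<rparr>)"
  unfolding wp_def by (metis exec_Assign exec_AssignE)

lemma wp_Store:
  "wp w (Store a i e) s Q \<longleftrightarrow> Q (1 + acost i + acost e)
     (s\<lparr>arrs := (arrs s)(a := (arrs s a)[aval w i s := aval w e s])\<rparr>)"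
  unfolding wp_def by (metis exec_Store exec_StoreE)

lemma wp_New:
  "wp w (New a e) s Q \<longleftrightarrow> Q (1 + acost e + aval w e s)
     (s\<lparr>arrs := (arrs s)(a := replicate (aval w e s) 0)\<rparr>)"
  unfolding wp_def by (metis exec_New exec_NewE)

lemma wp_Seq: "wp w (Seq C D) s Q \<longleftrightarrow> wp w C s (\<lambda>t s'. wp w D s' (\<lambda>u s''. Q (t + u) s''))"
  unfolding wp_def by (blast elim: exec_SeqE intro: exec_Seq)

lemma wp_Cond:
  "wp w (Cond b C D) s Q \<longleftrightarrow>
     wp w (if aval w b s \<noteq> 0 then C else D) s (\<lambda>t s'. Q (1 + acost b + t) s')"
proof
  assume "wp w (Cond b C D) s Q"
  then show "wp w (if aval w b s \<noteq> 0 then C else D) s (\<lambda>t s'. Q (1 + acost b + t) s')"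
    unfolding wp_def by (auto elim!: exec_CondE)
next
  assume "wp w (if aval w b s \<noteq> 0 then C else D) s (\<lambda>t s'. Q (1 + acost b + t) s')"
  then show "wp w (Cond b C D) s Q"
    unfolding wp_def using exec_CondTrue exec_CondFalse by (metis (full_types))
qed

lemmas wp_simps = wp_Skip wp_Assign wp_Store wp_New wp_Seq wp_Cond

section \<open>Frame conditions and counting loops\<close>

fun wvars :: "com \<Rightarrow> vname set" where
  "wvars (Assign x e) = {x}"
| "wvars (Seq C D) = wvars C \<union> wvars D"
| "wvars (Cond b C D) = wvars C \<union> wvars D"
| "wvars (While b C) = wvars C"
| "wvars _ = {}"

fun warrs :: "com \<Rightarrow> aname set" where
  "warrs (Store a i e) = {a}"
| "warrs (New a e) = {a}"
| "warrs (Seq C D) = warrs C \<union> warrs D"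
| "warrs (Cond b C D) = warrs C \<union> warrs D"
| "warrs (While b C) = warrs C"
| "warrs _ = {}"

lemma exec_frame:
  assumes "exec w P s t s'"
  shows "y \<notin> wvars P \<Longrightarrow> vars s' y = vars s y" "a \<notin> warrs P \<Longrightarrow> arrs s' a = arrs s a"
  using assms by (induction rule: exec.induct) auto

text \<open>The bound \<open>b\<close> is re-read in every iteration, so the body must not write to it.\<close>
definition For :: "vname \<Rightarrow> vname \<Rightarrow> com \<Rightarrow> com" where
  "For x b C = Seq (Assign x (Const 0))
     (While (Bin Less (Var x) (Var b)) (Seq C (Assign x (Bin Plus (Var x) (Const 1)))))"

lemma wvars_For [simp]: "wvars (For x b C) = insert x (wvars C)"
  and warrs_For [simp]: "warrs (For x b C) = warrs C"
  by (auto simp: For_def)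

text \<open>Initialisation costs 2, each test 4 (including the failing last one) and each increment
  4: in total 6, plus \<open>T + 8\<close> per round. The bound on \<open>m\<close> keeps the
  counter from being truncated. The frame facts are handed to \<open>step\<close>, so an invariant
  need only mention what the body changes.\<close>

lemma wp_For:
  assumes b: "vars s b = m" "b \<noteq> x" "b \<notin> wvars C" and x: "x \<notin> wvars C"
    and m: "m < 2 ^ w"
    and init: "I 0 (s\<lparr>vars := (vars s)(x := 0)\<rparr>)"
    and step: "\<And>i s'. \<lbrakk>i < m; I i s'; vars s' x = i;
        \<And>y. y \<noteq> x \<Longrightarrow> y \<notin> wvars C \<Longrightarrow> vars s' y = vars s y;
        \<And>a. a \<notin> warrs C \<Longrightarrow> arrs s' a = arrs s a\<rbrakk> \<Longrightarrow>
      wp w C s' (\<lambda>t s''. t \<le> T \<and> I (Suc i) (s''\<lparr>vars := (vars s'')(x := Suc i)\<rparr>))"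
  shows "wp w (For x b C) s (\<lambda>t s'. t \<le> 6 + m * (T + 8) \<and> I m s' \<and>
     (\<forall>y. y \<noteq> x \<longrightarrow> y \<notin> wvars C \<longrightarrow> vars s' y = vars s y) \<and>
     (\<forall>a. a \<notin> warrs C \<longrightarrow> arrs s' a = arrs s a))"
proof (cases w)
  \<comment> \<open>With words of 0 bits every test evaluates to 0, but then
    \<open>m < 2 ^ w\<close> forces \<open>m = 0\<close>.\<close>
  case 0
  then have "m = 0" using m by simp
  then show ?thesis
    using b init 0 unfolding For_def wp_Seq wp_Assign
    by (intro wpI[OF exec_WhileFalse]) auto
next
  case (Suc w')
  let ?B = "Bin Less (Var x) (Var b)"
  let ?D = "Seq C (Assign x (Bin Plus (Var x) (Const 1)))"
  \<comment> \<open>Generalised to a loop with \<open>i\<close> rounds done and \<open>d\<close>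
    rounds left, for induction on \<open>d\<close>.\<close>
  have loop: "wp w (While ?B ?D) s' (\<lambda>t s''. t \<le> 4 + d * (T + 8) \<and> I m s'' \<and>
       (\<forall>y. y \<noteq> x \<longrightarrow> y \<notin> wvars C \<longrightarrow> vars s'' y = vars s y) \<and>
       (\<forall>a. a \<notin> warrs C \<longrightarrow> arrs s'' a = arrs s a))"
    if "m = i + d" "I i s'" "vars s' x = i"
      "\<And>y. y \<noteq> x \<Longrightarrow> y \<notin> wvars C \<Longrightarrow> vars s' y = vars s y"
      "\<And>a. a \<notin> warrs C \<Longrightarrow> arrs s' a = arrs s a" for i d s'
    using that
  proof (induction d arbitrary: i s')
    case 0
    then show ?case
      using b by (intro wpI[OF exec_WhileFalse]) auto
  next
    case (Suc d)
    have sb: "vars s' b = m" using Suc.prems b by simp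
    have test: "aval w ?B s' \<noteq> 0"
      using Suc.prems sb \<open>w = Suc w'\<close> by simp
    obtain t s1 where t: "exec w C s' t s1" "t \<le> T"
        "I (Suc i) (s1\<lparr>vars := (vars s1)(x := Suc i)\<rparr>)"
      using step[of i s'] Suc.prems unfolding wp_def by auto
    have s1x: "vars s1 x = i" using exec_frame(1)[OF t(1) x] Suc.prems by simp
    have inc: "aval w (Bin Plus (Var x) (Const 1)) s1 = Suc i"
      using s1x m Suc.prems \<open>w = Suc w'\<close> by (simp add: take_bit_nat_eq_self)
    have body: "exec w ?D s' (t + 4) (s1\<lparr>vars := (vars s1)(x := Suc i)\<rparr>)"
      using exec_Seq[OF t(1) exec_Assign[of w x "Bin Plus (Var x) (Const 1)"]] inc
      by (simp add: numeral_eq_Suc)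
    have "wp w (While ?B ?D) (s1\<lparr>vars := (vars s1)(x := Suc i)\<rparr>)
       (\<lambda>t s''. t \<le> 4 + d * (T + 8) \<and> I m s'' \<and>
       (\<forall>y. y \<noteq> x \<longrightarrow> y \<notin> wvars C \<longrightarrow> vars s'' y = vars s y) \<and>
       (\<forall>a. a \<notin> warrs C \<longrightarrow> arrs s'' a = arrs s a))"
      using Suc.prems t exec_frame[OF t(1)] by (intro Suc.IH[of "Suc i"]) auto
    then obtain u s2 where u: "exec w (While ?B ?D) (s1\<lparr>vars := (vars s1)(x := Suc i)\<rparr>) u s2"
        "u \<le> 4 + d * (T + 8)" "I m s2"
       "\<forall>y. y \<noteq> x \<longrightarrow> y \<notin> wvars C \<longrightarrow> vars s2 y = vars s y"
       "\<forall>a. a \<notin> warrs C \<longrightarrow> arrs s2 a = arrs s a"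
      unfolding wp_def by blast
    show ?case
      by (rule wpI[OF exec_WhileTrue[OF test body u(1)]]) (use u t in simp)
  qed
  show ?thesis
    unfolding For_def wp_Seq wp_Assign
    by (rule wp_mono[OF loop[of 0 m]]) (use init in auto)
qed

section \<open>Programs mention only finitely many names\<close>

fun aexp_below :: "nat \<Rightarrow> aexp \<Rightarrow> bool" where
  "aexp_below K (Const c) \<longleftrightarrow> True"
| "aexp_below K (Var x) \<longleftrightarrow> x < K"
| "aexp_below K (Bin f d e) \<longleftrightarrow> aexp_below K d \<and> aexp_below K e"
| "aexp_below K (Read a e) \<longleftrightarrow> a < K \<and> aexp_below K e"
| "aexp_below K (Len a) \<longleftrightarrow> a < K"

fun com_below :: "nat \<Rightarrow> com \<Rightarrow> bool" where
  "com_below K Skip \<longleftrightarrow> True"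
| "com_below K (Assign x e) \<longleftrightarrow> x < K \<and> aexp_below K e"
| "com_below K (Store a i e) \<longleftrightarrow> a < K \<and> aexp_below K i \<and> aexp_below K e"
| "com_below K (New a e) \<longleftrightarrow> a < K \<and> aexp_below K e"
| "com_below K (Seq C D) \<longleftrightarrow> com_below K C \<and> com_below K D"
| "com_below K (Cond b C D) \<longleftrightarrow> aexp_below K b \<and> com_below K C \<and> com_below K D"
| "com_below K (While b C) \<longleftrightarrow> aexp_below K b \<and> com_below K C"

lemma aexp_below_mono: "aexp_below K e \<Longrightarrow> K \<le> L \<Longrightarrow> aexp_below L e"
  by (induction e) auto

lemma com_below_mono: "com_below K C \<Longrightarrow> K \<le> L \<Longrightarrow> com_below L C"
  by (induction C) (auto intro: aexp_below_mono)

lemma ex_aexp_below: "\<exists>K. aexp_below K e"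
proof (induction e)
  case (Bin f d e)
  then show ?case by (metis aexp_below.simps(3) aexp_below_mono max.cobounded1 max.cobounded2)
next
  case (Read a e)
  then obtain K where "aexp_below K e" by blast
  then show ?case by (intro exI[of _ "max (Suc a) K"]) (auto intro: aexp_below_mono)
qed auto

lemma ex_com_below: "\<exists>K. com_below K C"
proof (induction C)
  case (Assign x e)
  obtain K where "aexp_below K e" using ex_aexp_below by blast
  then show ?case by (intro exI[of _ "max (Suc x) K"]) (auto intro: aexp_below_mono)
next
  case (Store a i e)
  obtain K L where "aexp_below K i" "aexp_below L e" using ex_aexp_below by blast
  then show ?case by (intro exI[of _ "max (Suc a) (max K L)"]) (auto intro: aexp_below_mono)
next
  case (New a e)
  obtain K where "aexp_below K e" using ex_aexp_below by blast
  then show ?case by (intro exI[of _ "max (Suc a) K"]) (auto intro: aexp_below_mono)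
next
  case (Seq C D)
  then obtain K L where "com_below K C" "com_below L D" by blast
  then show ?case by (intro exI[of _ "max K L"]) (auto intro: com_below_mono)
next
  case (Cond b C D)
  obtain J where "aexp_below J b" using ex_aexp_below by blast
  moreover obtain K L where "com_below K C" "com_below L D" using Cond by blast
  ultimately show ?case
    by (intro exI[of _ "max J (max K L)"]) (auto intro: com_below_mono aexp_below_mono)
next
  case (While b C)
  obtain J where "aexp_below J b" using ex_aexp_below by blast
  moreover obtain K where "com_below K C" using While by blast
  ultimately show ?case
    by (intro exI[of _ "max J K"]) (auto intro: com_below_mono aexp_below_mono)
qed auto

lemma com_below_wvars: "com_below K C \<Longrightarrow> wvars C \<subseteq> {..<K}"
  by (induction C) auto

lemma com_below_warrs: "com_below K C \<Longrightarrow> warrs C \<subseteq> {..<K}"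
  by (induction C) auto

definition agree :: "nat \<Rightarrow> state \<Rightarrow> state \<Rightarrow> bool" where
  "agree K s r \<longleftrightarrow> (\<forall>x<K. vars s x = vars r x \<and> arrs s x = arrs r x)"

lemma aval_agree: "aexp_below K e \<Longrightarrow> agree K s r \<Longrightarrow> aval w e s = aval w e r"
  by (induction e) (auto simp: agree_def Let_def)

text \<open>A run is blind to names that its program does not mention. This transfers the guarantee
  for the multiplication program from clean initial states to states holding further data at names
  from \<open>K\<close> on.\<close>

lemma exec_agree:
  assumes "exec w P s t s'"
  shows "com_below K P \<Longrightarrow> agree K s r \<Longrightarrow> \<exists>r'. exec w P r t r' \<and> agree K s' r'"
  using assms
proof (induction arbitrary: r rule: exec.induct)
  case exec_Skip
  then show ?case by (blast intro: exec.exec_Skip)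
next
  case (exec_Assign x e s)
  have "aval w e s = aval w e r" using exec_Assign by (auto intro!: aval_agree)
  with exec_Assign show ?case
    by (intro exI[of _ "r\<lparr>vars := (vars r)(x := aval w e r)\<rparr>"] conjI exec.exec_Assign)
      (auto simp: agree_def)
next
  case (exec_Store a i e s)
  have "aval w i s = aval w i r" "aval w e s = aval w e r"
    using exec_Store by (auto intro!: aval_agree)
  with exec_Store show ?case
    by (intro exI[of _ "r\<lparr>arrs := (arrs r)(a := (arrs r a)[aval w i r := aval w e r])\<rparr>"]
        conjI exec.exec_Store) (auto simp: agree_def)
next
  case (exec_New a e s)
  have "aval w e s = aval w e r" using exec_New by (auto intro!: aval_agree)
  with exec_New show ?case
    using exec.exec_New[of w a e r]
    by (intro exI[of _ "r\<lparr>arrs := (arrs r)(a := replicate (aval w e r) 0)\<rparr>"] conjI)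
      (auto simp: agree_def)
next
  case exec_Seq
  then show ?case by (metis com_below.simps(5) exec.exec_Seq)
next
  case exec_CondTrue
  then show ?case by (metis com_below.simps(6) exec.exec_CondTrue aval_agree)
next
  case exec_CondFalse
  then show ?case by (metis com_below.simps(6) exec.exec_CondFalse aval_agree)
next
  case exec_WhileFalse
  then show ?case by (metis com_below.simps(7) exec.exec_WhileFalse aval_agree)
next
  case exec_WhileTrue
  then show ?case by (metis com_below.simps(7) exec.exec_WhileTrue aval_agree)
qed

text \<open>Allocation is the only command that can lengthen an array, and it is charged the new
  length.\<close>

lemma exec_array_length: "exec w P s t s' \<Longrightarrow> length (arrs s' a) \<le> length (arrs s a) + t"
  by (induction rule: exec.induct) auto

text \<open>The output array 2 starts empty and ends with \<open>n * n\<close> entries, so the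
  running time is at least quadratic.\<close>

lemma matrix_multiplication_exponent_ge_2:
  assumes "multiplies_binary_matrices P (\<lambda>n. real n powr \<omega>)"
  shows "\<omega> \<ge> 2"
proof -
  obtain k T where T: "(\<lambda>n. real (T n)) \<in> O(\<lambda>n. real n powr \<omega>)"
    and run: "\<And>n A B w. (n + 2) ^ k \<le> 2 ^ w \<Longrightarrow> \<exists>t s'.
      exec w P \<lparr>vars = (\<lambda>_. 0)(0 := n),
        arrs = (\<lambda>_. [])(0 := encode_matrix n A, 1 := encode_matrix n B)\<rparr> t s' \<and>
      t \<le> T n \<and> arrs s' 2 = encode_matrix n (matrix_product n A B)"
    using assms unfolding multiplies_binary_matrices_def runs_in_time_def by auto
  have "n\<^sup>2 \<le> T n" for n
  proof -
    \<comment> \<open>An admissible word size exists for every \<open>n\<close>: words of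
      \<open>(n + 2) * k\<close> bits suffice.\<close>
    have "(n + 2) ^ k \<le> (2 ^ (n + 2)) ^ k"
      using less_exp[of "n + 2"] by (intro power_mono less_imp_le) simp_all
    then obtain w where "(n + 2) ^ k \<le> 2 ^ w" by (metis power_mult)
    from run[OF this] obtain A B t s' where
      "exec w P \<lparr>vars = (\<lambda>_. 0)(0 := n),
        arrs = (\<lambda>_. [])(0 := encode_matrix n A, 1 := encode_matrix n B)\<rparr> t s'"
      "t \<le> T n" "arrs s' 2 = encode_matrix n (matrix_product n A B)" by blast
    from exec_array_length[OF this(1), of 2] this(2,3) show ?thesis
      by (simp add: encode_matrix_def power2_eq_square)
  qed
  then have "(\<lambda>n. real n powr 2) \<in> O(\<lambda>n. real (T n))"
    by (intro bigoI[of _ 1] always_eventually) (auto simp flip: of_nat_power)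
  from landau_o.big_trans[OF this T] have "(\<lambda>n. real n powr 2) \<in> O(\<lambda>n. real n powr \<omega>)" .
  then show ?thesis
    using powr_bigo_iff[OF filterlim_real_sequentially sequentially_bot, of 2 \<omega>] by blast
qed

section \<open>The program and its verification\<close>

text \<open>Names below \<open>K\<close> belong to the multiplication program.\<close>

abbreviation (input) "vN K \<equiv> K + 3"
abbreviation (input) "vV K \<equiv> K + 4"
abbreviation (input) "vU K \<equiv> K + 5"
abbreviation (input) "vX K \<equiv> K + 6"
abbreviation (input) "vFlag K \<equiv> K + 7"
abbreviation (input) "vCount K \<equiv> K + 8"
abbreviation (input) "vSquare K \<equiv> K + 9"

abbreviation (input) "aAdj K \<equiv> K + 3"
abbreviation (input) "aLabel K \<equiv> K + 4"
abbreviation (input) "aMark K \<equiv> K + 5"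
abbreviation (input) "aRes K \<equiv> K + 6"

definition Neg :: "aexp \<Rightarrow> aexp" where
  "Neg e = Bin Eq e (Const 0)"

text \<open>Bitwise \<open>And\<close> of two nonzero words can be 0; De Morgan with
  \<open>Neg\<close> reduces both to 0 or 1 first.\<close>

definition Conj :: "aexp \<Rightarrow> aexp \<Rightarrow> aexp" where
  "Conj d e = Neg (Bin Or (Neg d) (Neg e))"

definition Entry :: "nat \<Rightarrow> aexp \<Rightarrow> aexp \<Rightarrow> aexp" where
  "Entry K i j = Bin Plus (Bin Times i (Var (vN K))) j"

definition Adj :: "nat \<Rightarrow> vname \<Rightarrow> vname \<Rightarrow> aexp" where
  "Adj K x y = Read (aAdj K) (Entry K (Var x) (Var y))"

definition Outside :: "nat \<Rightarrow> vname \<Rightarrow> aexp" where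
  "Outside K u = Conj (Neg (Bin Eq (Var u) (Var (vV K)))) (Neg (Adj K (vV K) u))"

definition copy_array :: "vname \<Rightarrow> vname \<Rightarrow> aname \<Rightarrow> aname \<Rightarrow> com" where
  "copy_array x b dst src =
     Seq (New dst (Var b)) (For x b (Store dst (Var x) (Read src (Var x))))"

definition mark_prog :: "nat \<Rightarrow> com" where
  "mark_prog K = For (vX K) (vU K)
     (Cond (Conj (Conj (Outside K (vU K)) (Outside K (vX K))) (Adj K (vU K) (vX K)))
        (Store (aMark K) (Read (aLabel K) (Var (vX K))) (Const 1)) Skip)"

definition relabel_prog :: "nat \<Rightarrow> com" where
  "relabel_prog K = For (vX K) (vU K)
     (Cond (Read (aMark K) (Read (aLabel K) (Var (vX K))))
        (Store (aLabel K) (Var (vX K)) (Var (vU K))) Skip)"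

text \<open>Marking the labels adjacent to the new vertex and rewriting marked labels in a second
  pass takes linear time, however many components merge.\<close>

definition label_step :: "nat \<Rightarrow> com" where
  "label_step K = Seq (New (aMark K) (Var (vN K))) (Seq (mark_prog K) (Seq (relabel_prog K)
     (Store (aLabel K) (Var (vU K)) (Var (vU K)))))"

definition label_prog :: "nat \<Rightarrow> com" where
  "label_prog K = Seq (New (aLabel K) (Var (vN K))) (For (vU K) (vN K) (label_step K))"

text \<open>Each incidence goes to array 0 and, transposed, to array 1, so that both factors of the
  product are built together.\<close>

definition fill_row :: "nat \<Rightarrow> com" where
  "fill_row K = For (vX K) (vN K)
     (Cond (Conj (Conj (Adj K (vV K) (vX K)) (Outside K (vU K))) (Adj K (vX K) (vU K)))
        (Seq (Store 0 (Entry K (Var (vX K)) (Read (aLabel K) (Var (vU K)))) (Const 1))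
             (Store 1 (Entry K (Read (aLabel K) (Var (vU K))) (Var (vX K))) (Const 1))) Skip)"

definition fill_prog :: "nat \<Rightarrow> com" where
  "fill_prog K = For (vU K) (vN K) (fill_row K)"

text \<open>
  The multiplication program is only specified for runs in which its scratch variables and arrays
  start out zero and empty, so they have to be cleared between two calls.
\<close>
primrec reset_prog :: "nat \<Rightarrow> com" where
  "reset_prog 0 = Skip"
| "reset_prog (Suc k) = Seq (reset_prog k) (Seq (Assign k (Const 0)) (New k (Const 0)))"

definition product_prog :: "nat \<Rightarrow> com \<Rightarrow> com" where
  "product_prog K P = Seq (reset_prog K) (Seq (Assign 0 (Var (vN K)))
     (Seq (New 0 (Bin Times (Var (vN K)) (Var (vN K))))
     (Seq (New 1 (Bin Times (Var (vN K)) (Var (vN K)))) (Seq (fill_prog K) P))))"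

definition check_row :: "nat \<Rightarrow> com" where
  "check_row K = For (vX K) (vN K)
     (Cond (Conj (Conj (Conj (Adj K (vV K) (vU K)) (Adj K (vV K) (vX K)))
              (Neg (Bin Eq (Var (vU K)) (Var (vX K)))))
            (Conj (Neg (Adj K (vU K) (vX K))) (Neg (Read 2 (Entry K (Var (vU K)) (Var (vX K)))))))
        (Assign (vFlag K) (Const 0)) Skip)"

definition check_prog :: "nat \<Rightarrow> com" where
  "check_prog K = Seq (Assign (vFlag K) (Const 1)) (For (vU K) (vN K) (check_row K))"

definition vertex_prog :: "nat \<Rightarrow> com \<Rightarrow> com" where
  "vertex_prog K P = Seq (label_prog K) (Seq (product_prog K P) (Seq (check_prog K)
     (Cond (Var (vFlag K))
        (Seq (Store (aRes K) (Var (vCount K)) (Var (vV K)))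
             (Assign (vCount K) (Bin Plus (Var (vCount K)) (Const 1)))) Skip)))"

text \<open>Arrays 0 and 1 hold the factors in every round. So the input is first saved in
  \<open>aAdj K\<close>, and the list grows in \<open>aRes K\<close>, whose filled prefix is copied
  to array 1 at the end. \<open>vSquare K\<close> exists because loop bounds are variables.\<close>

definition avoidable_prog :: "nat \<Rightarrow> com \<Rightarrow> com" where
  "avoidable_prog K P = Seq (Assign (vN K) (Var 0))
     (Seq (Assign (vSquare K) (Bin Times (Var 0) (Var 0)))
     (Seq (copy_array (vX K) (vSquare K) (aAdj K) 0)
     (Seq (New (aRes K) (Var (vN K)))
     (Seq (For (vV K) (vN K) (vertex_prog K P))
          (copy_array (vX K) (vCount K) 1 (aRes K))))))"

section \<open>Row-major matrices and auxiliary programs\<close>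

lemma map_upt_update: "i < n \<Longrightarrow> (map f [0..<n])[i := y] = map (f(i := y)) [0..<n]"
  by (rule nth_equalityI) (auto simp: nth_list_update)

lemma flat_index_less: "i < n \<Longrightarrow> j < n \<Longrightarrow> i * n + j < n * (n::nat)"
  using mult_le_mono1[of "Suc i" n n] by simp

lemma length_encode_matrix [simp]: "length (encode_matrix n M) = n * n"
  by (simp add: encode_matrix_def)

lemma nth_encode_matrix:
  "i < n \<Longrightarrow> j < n \<Longrightarrow> encode_matrix n M ! (i * n + j) = of_bool (M i j)"
  using flat_index_less[of i n j] by (simp add: encode_matrix_def)

lemma encode_matrix_cong:
  assumes "\<And>i j. i < n \<Longrightarrow> j < n \<Longrightarrow> M i j = M' i j"
  shows "encode_matrix n M = encode_matrix n M'"
proof -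
  have "k div n < n \<and> k mod n < n" if "k < n * n" for k
    using that by (metis less_mult_imp_div_less mod_less_divisor mult_0 not_gr_zero not_less_zero)
  then show ?thesis using assms by (auto simp: encode_matrix_def)
qed

lemma replicate_eq_encode_matrix: "replicate (n * n) 0 = encode_matrix n (\<lambda>_ _. False)"
  by (simp add: encode_matrix_def map_replicate_const)

lemma encode_matrix_update:
  assumes "i < n" "j < n"
  shows "(encode_matrix n M)[i * n + j := 1] =
    encode_matrix n (\<lambda>i' j'. M i' j' \<or> i' = i \<and> j' = j)"
proof (rule nth_equalityI)
  fix k
  assume "k < length ((encode_matrix n M)[i * n + j := 1])"
  then have k: "k < n * n" by simp
  have k_eq: "i * n + j = k \<longleftrightarrow> k div n = i \<and> k mod n = j"
    using assms by (auto simp: div_mult_mod_eq)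
  show "(encode_matrix n M)[i * n + j := 1] ! k =
    encode_matrix n (\<lambda>i' j'. M i' j' \<or> i' = i \<and> j' = j) ! k"
    using k k_eq by (auto simp: nth_list_update encode_matrix_def)
qed simp

lemma wp_copy_array:
  assumes "vars s b = m" "b \<noteq> x" "dst \<noteq> src" "m < 2 ^ w" "m \<le> length (arrs s src)"
  shows "wp w (copy_array x b dst src) s (\<lambda>t s'. t \<le> 8 + 13 * m \<and>
    arrs s' dst = take m (arrs s src) \<and>
    (\<forall>y. y \<noteq> x \<longrightarrow> vars s' y = vars s y) \<and> (\<forall>a. a \<noteq> dst \<longrightarrow> arrs s' a = arrs s a))"
proof -
  let ?s = "s\<lparr>arrs := (arrs s)(dst := replicate m 0)\<rparr>"
  let ?I = "\<lambda>i (s' :: state). arrs s' dst = take i (arrs s src) @ replicate (m - i) 0"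
  have loop: "wp w (For x b (Store dst (Var x) (Read src (Var x)))) ?s
    (\<lambda>t s'. t \<le> 6 + m * (4 + 8) \<and> ?I m s' \<and>
     (\<forall>y. y \<noteq> x \<longrightarrow> y \<notin> wvars (Store dst (Var x) (Read src (Var x))) \<longrightarrow> vars s' y = vars ?s y) \<and>
     (\<forall>a. a \<notin> warrs (Store dst (Var x) (Read src (Var x))) \<longrightarrow> arrs s' a = arrs ?s a))"
  proof (rule wp_For[where I = ?I])
    fix i and s' :: state
    assume "i < m" "?I i s'" "vars s' x = i"
      and "\<And>a. a \<notin> warrs (Store dst (Var x) (Read src (Var x))) \<Longrightarrow> arrs s' a = arrs ?s a"
    moreover have "(take i (arrs s src) @ replicate (m - i) 0)[i := arrs s src ! i] =
      take (Suc i) (arrs s src) @ replicate (m - Suc i) 0"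
      using \<open>i < m\<close> assms by (intro nth_equalityI)
        (auto simp: nth_append nth_list_update less_Suc_eq min_def)
    ultimately show "wp w (Store dst (Var x) (Read src (Var x))) s'
      (\<lambda>t s''. t \<le> 4 \<and> ?I (Suc i) (s''\<lparr>vars := (vars s'')(x := Suc i)\<rparr>))"
      using assms by (simp add: wp_simps)
  qed (use assms in auto)
  have b: "aval w (Var b) s = m" using assms by simp
  show ?thesis
    unfolding copy_array_def wp_Seq wp_New b by (rule wp_mono[OF loop]) auto
qed

lemma wp_reset_prog:
  "wp w (reset_prog k) s Q \<longleftrightarrow> Q (1 + 4 * k)
     (s\<lparr>vars := (\<lambda>x. if x < k then 0 else vars s x),
        arrs := (\<lambda>b. if b < k then [] else arrs s b)\<rparr>)"
proof (induction k arbitrary: Q)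
  case (Suc k)
  have "(\<lambda>x. if x < k then 0 else vars s x)(k := 0) = (\<lambda>x. if x < Suc k then 0 else vars s x)"
    "(\<lambda>b. if b < k then [] else arrs s b)(k := []) = (\<lambda>b. if b < Suc k then [] else arrs s b)"
    by (auto simp: fun_eq_iff less_Suc_eq)
  then show ?case by (simp add: wp_simps Suc.IH numeral_eq_Suc)
qed (simp add: wp_simps)

lemma wvars_reset_prog [simp]: "wvars (reset_prog k) = {..<k}"
  and warrs_reset_prog [simp]: "warrs (reset_prog k) = {..<k}"
  by (induction k) (simp_all add: lessThan_Suc)

lemma acost_simps [simp]:
  "acost (Neg e) = 2 + acost e"
  "acost (Conj d e) = 7 + acost d + acost e"
  "acost (Entry K d e) = 3 + acost d + acost e"
  "acost (Adj K x y) = 6"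
  "acost (Outside K u) = 20"
  by (simp_all add: Neg_def Conj_def Entry_def Adj_def Outside_def)

text \<open>\<open>fits\<close> covers all matrix indices, the loop bounds \<open>n\<close> and
  \<open>n * n\<close>, and the counters, so none of them is truncated; \<open>w_pos\<close> makes 1
  and the truth values representable.\<close>

locale instance_run =
  fixes K n w :: nat and a :: "nat \<Rightarrow> nat \<Rightarrow> bool"
  assumes fits: "n * n + n < 2 ^ w" and w_pos: "0 < w"
begin

text \<open>What all subprograms of the round for \<open>v\<close> rely on; none of them writes to
  these names.\<close>

definition ready :: "nat \<Rightarrow> state \<Rightarrow> bool" where
  "ready v s \<longleftrightarrow> v < n \<and> vars s (vN K) = n \<and> vars s (vV K) = v \<and> arrs s (aAdj K) = encode_matrix n a"

lemma less_word: "m \<le> n * n + n \<Longrightarrow> m < 2 ^ w"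
  using fits by linarith

lemma aval_Neg: "aval w (Neg e) s = of_bool (aval w e s = 0)"
  using w_pos by (simp add: Neg_def)

lemma aval_Conj: "aval w (Conj d e) s = of_bool (aval w d s \<noteq> 0 \<and> aval w e s \<noteq> 0)"
  using w_pos by (auto simp: Conj_def aval_Neg)

lemma aval_Entry:
  assumes "vars s (vN K) = n" "aval w d s < n" "aval w e s < n"
  shows "aval w (Entry K d e) s = aval w d s * n + aval w e s"
proof -
  have "aval w d s * n + aval w e s < n * n" using assms by (intro flat_index_less)
  then have "aval w d s * n < 2 ^ w" "aval w d s * n + aval w e s < 2 ^ w"
    using fits by linarith+
  then show ?thesis using assms by (simp add: Entry_def take_bit_nat_eq_self)
qed

lemma aval_Adj:
  assumes "ready v s" "vars s x < n" "vars s y < n"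
  shows "aval w (Adj K x y) s = of_bool (a (vars s x) (vars s y))"
  using assms aval_Entry[of s "Var x" "Var y"] flat_index_less[of "vars s x" n "vars s y"]
  by (simp add: Adj_def ready_def nth_encode_matrix)

lemma aval_Outside:
  assumes "ready v s" "vars s u < n"
  shows "aval w (Outside K u) s = of_bool (outside a v (vars s u))"
  using assms aval_Adj[of v s "vV K" u] w_pos
  by (auto simp: Outside_def aval_Conj aval_Neg outside_def ready_def)

section \<open>Component labelling in quadratic time\<close>

lemma wp_mark_prog:
  assumes s: "ready v s" "vars s (vU K) = u" "u < n"
    and l: "arrs s (aLabel K) = map (label (outer_adj a v) u) [0..<n]"
    and m: "arrs s (aMark K) = replicate n 0"
  shows "wp w (mark_prog K) s (\<lambda>t s'. t \<le> 6 + 100 * n \<and>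
    arrs s' (aMark K) =
      map (\<lambda>c. of_bool (\<exists>y<u. outer_adj a v u y \<and> label (outer_adj a v) u y = c)) [0..<n] \<and>
    (\<forall>y. y \<noteq> vX K \<longrightarrow> vars s' y = vars s y) \<and> (\<forall>b. b \<noteq> aMark K \<longrightarrow> arrs s' b = arrs s b))"
proof -
  let ?H = "outer_adj a v"
  let ?m = "\<lambda>i c. of_bool (\<exists>y<i. ?H u y \<and> label ?H u y = c) :: nat"
  let ?I = "\<lambda>i (s' :: state). arrs s' (aMark K) = map (?m i) [0..<n]"
  let ?C = "Cond (Conj (Conj (Outside K (vU K)) (Outside K (vX K))) (Adj K (vU K) (vX K)))
        (Store (aMark K) (Read (aLabel K) (Var (vX K))) (Const 1)) Skip"
  \<comment> \<open>The body costs at most 65; 92 is rounded up so that the loop overhead 8 gives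
    100 per round. The later body bounds are generous in the same way.\<close>
  have "wp w (mark_prog K) s (\<lambda>t s'. t \<le> 6 + u * (92 + 8) \<and> ?I u s' \<and>
     (\<forall>y. y \<noteq> vX K \<longrightarrow> y \<notin> wvars ?C \<longrightarrow> vars s' y = vars s y) \<and>
     (\<forall>a. a \<notin> warrs ?C \<longrightarrow> arrs s' a = arrs s a))"
    unfolding mark_prog_def
  proof (rule wp_For[where I = ?I])
    fix i and s' :: state
    assume i: "i < u" and inv: "?I i s'" and x: "vars s' (vX K) = i"
      and fv: "\<And>y. y \<noteq> vX K \<Longrightarrow> y \<notin> wvars ?C \<Longrightarrow> vars s' y = vars s y"
      and fa: "\<And>a. a \<notin> warrs ?C \<Longrightarrow> arrs s' a = arrs s a"
    have s': "ready v s'" "vars s' (vU K) = u" using s fv fa by (auto simp: ready_def)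
    have l': "arrs s' (aLabel K) = map (label ?H u) [0..<n]" using l fa by simp
    have "label ?H u i < n" using label_less[OF i, of ?H] s(3) by simp
    then have upd: "(map (?m i) [0..<n])[label ?H u i := Suc 0] = map (?m (Suc i)) [0..<n]"
      if "?H u i" using that by (subst map_upt_update) (auto simp: less_Suc_eq)
    have noupd: "map (?m i) [0..<n] = map (?m (Suc i)) [0..<n]" if "\<not> ?H u i"
      using that by (auto simp: less_Suc_eq)
    show "wp w ?C s' (\<lambda>t s''. t \<le> 92 \<and> ?I (Suc i) (s''\<lparr>vars := (vars s'')(vX K := Suc i)\<rparr>))"
      using s s' x i inv l' upd noupd w_pos
      by (auto simp: wp_simps aval_Conj aval_Outside[OF s'(1)] aval_Adj[OF s'(1)] outer_adj_def)
  qed (use s m less_word in \<open>auto simp: map_replicate_const\<close>)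
  then show ?thesis
    using s(3) by (elim wp_mono) auto
qed

text \<open>The loop stops before \<open>u\<close>; the update at \<open>u\<close> in the conclusion
  anticipates the store that follows it in \<open>label_step\<close>.\<close>

lemma wp_relabel_prog:
  assumes s: "ready v s" "vars s (vU K) = u" "u < n"
    and l: "arrs s (aLabel K) = map (label (outer_adj a v) u) [0..<n]"
    and m: "arrs s (aMark K) =
      map (\<lambda>c. of_bool (\<exists>y<u. outer_adj a v u y \<and> label (outer_adj a v) u y = c)) [0..<n]"
  shows "wp w (relabel_prog K) s (\<lambda>t s'. t \<le> 6 + 20 * n \<and>
    (arrs s' (aLabel K))[u := u] = map (label (outer_adj a v) (Suc u)) [0..<n] \<and>
    (\<forall>y. y \<noteq> vX K \<longrightarrow> vars s' y = vars s y) \<and> (\<forall>b. b \<noteq> aLabel K \<longrightarrow> arrs s' b = arrs s b))"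
proof -
  let ?H = "outer_adj a v"
  let ?q = "\<lambda>x. \<exists>y<u. ?H u y \<and> label ?H u y = label ?H u x"
  \<comment> \<open>Entry \<open>x\<close> is rewritten only in round \<open>x\<close>, so the test
    of round \<open>i\<close> still sees the old label of \<open>i\<close> although the array
    changes in place.\<close>
  let ?l = "\<lambda>i x. if x < i \<and> ?q x then u else label ?H u x"
  let ?I = "\<lambda>i (s' :: state). arrs s' (aLabel K) = map (?l i) [0..<n]"
  let ?C = "Cond (Read (aMark K) (Read (aLabel K) (Var (vX K))))
        (Store (aLabel K) (Var (vX K)) (Var (vU K))) Skip"
  have "wp w (relabel_prog K) s (\<lambda>t s'. t \<le> 6 + u * (12 + 8) \<and> ?I u s' \<and>
     (\<forall>y. y \<noteq> vX K \<longrightarrow> y \<notin> wvars ?C \<longrightarrow> vars s' y = vars s y) \<and>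
     (\<forall>a. a \<notin> warrs ?C \<longrightarrow> arrs s' a = arrs s a))"
    unfolding relabel_prog_def
  proof (rule wp_For[where I = ?I])
    fix i and s' :: state
    assume i: "i < u" and inv: "?I i s'" and x: "vars s' (vX K) = i"
      and fv: "\<And>y. y \<noteq> vX K \<Longrightarrow> y \<notin> wvars ?C \<Longrightarrow> vars s' y = vars s y"
      and fa: "\<And>a. a \<notin> warrs ?C \<Longrightarrow> arrs s' a = arrs s a"
    have u: "vars s' (vU K) = u" using s fv by simp
    have c: "label ?H u i < n" using label_less[OF i, of ?H] s(3) by simp
    have test: "aval w (Read (aMark K) (Read (aLabel K) (Var (vX K)))) s' = of_bool (?q i)"
      using x i s(3) inv m fa c by simp
    have upd: "(map (?l i) [0..<n])[i := u] = map (?l (Suc i)) [0..<n]" if "?q i"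
      using that i s(3) by (subst map_upt_update) (auto simp: less_Suc_eq)
    have noupd: "map (?l i) [0..<n] = map (?l (Suc i)) [0..<n]" if "\<not> ?q i"
      using that by (intro map_cong refl) (metis less_Suc_eq)
    show "wp w ?C s' (\<lambda>t s''. t \<le> 12 \<and> ?I (Suc i) (s''\<lparr>vars := (vars s'')(vX K := Suc i)\<rparr>))"
    proof (cases "?q i")
      case True
      then show ?thesis
        unfolding wp_Cond test using x u inv upd by (simp add: wp_simps)
    next
      case False
      then show ?thesis
        unfolding wp_Cond test using inv noupd[OF False] by (simp add: wp_simps)
    qed
  qed (use s l less_word in auto)
  moreover have "(map (?l u) [0..<n])[u := u] = map (label ?H (Suc u)) [0..<n]"
    using s(3) by (subst map_upt_update) auto
  ultimately show ?thesis
    using s(3) by (elim wp_mono) auto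
qed

lemma wp_label_step:
  assumes s: "ready v s" "vars s (vU K) = u" "u < n"
    and l: "arrs s (aLabel K) = map (label (outer_adj a v) u) [0..<n]"
  shows "wp w (label_step K) s (\<lambda>t s'. t \<le> 20 + 130 * n \<and>
    arrs s' (aLabel K) = map (label (outer_adj a v) (Suc u)) [0..<n])"
proof -
  let ?s = "s\<lparr>arrs := (arrs s)(aMark K := replicate n 0)\<rparr>"
  have n: "aval w (Var (vN K)) s = n" using s by (simp add: ready_def)
  have s': "ready v ?s" "vars ?s (vU K) = u" using s by (auto simp: ready_def)
  show ?thesis
    unfolding label_step_def wp_Seq wp_New n
  proof (rule wp_mono[OF wp_mark_prog[OF s' s(3)]], goal_cases)
    case (3 t s1)
    then have s1: "ready v s1" "vars s1 (vU K) = u"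
      "arrs s1 (aLabel K) = map (label (outer_adj a v) u) [0..<n]"
      using s l by (auto simp: ready_def)
    from 3 show ?case
      by (intro wp_mono[OF wp_relabel_prog[OF s1(1,2) s(3) s1(3)]]) (use s1 in \<open>auto simp: wp_simps\<close>)
  qed (use l in auto)
qed

text \<open>The zero-initialised array is \<open>label H 0\<close>, and each of the \<open>n\<close>
  rounds is linear.\<close>

lemma wp_label_prog:
  assumes s: "ready v s"
  shows "wp w (label_prog K) s (\<lambda>t s'. t \<le> 10 + 30 * n + 130 * (n * n) \<and>
    arrs s' (aLabel K) = map (label (outer_adj a v) n) [0..<n] \<and>
    (\<forall>y. y \<noteq> vU K \<longrightarrow> y \<noteq> vX K \<longrightarrow> vars s' y = vars s y) \<and>
    (\<forall>b. b \<noteq> aLabel K \<longrightarrow> b \<noteq> aMark K \<longrightarrow> arrs s' b = arrs s b))"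
proof -
  let ?s = "s\<lparr>arrs := (arrs s)(aLabel K := replicate n 0)\<rparr>"
  let ?I = "\<lambda>i (s' :: state). arrs s' (aLabel K) = map (label (outer_adj a v) i) [0..<n]"
  have writes: "wvars (label_step K) = {vX K}" "warrs (label_step K) = {aLabel K, aMark K}"
    by (auto simp: label_step_def mark_prog_def relabel_prog_def)
  have n: "aval w (Var (vN K)) s = n" using s by (simp add: ready_def)
  have loop: "wp w (For (vU K) (vN K) (label_step K)) ?s
    (\<lambda>t s'. t \<le> 6 + n * (20 + 130 * n + 8) \<and> ?I n s' \<and>
     (\<forall>y. y \<noteq> vU K \<longrightarrow> y \<notin> wvars (label_step K) \<longrightarrow> vars s' y = vars ?s y) \<and>
     (\<forall>a. a \<notin> warrs (label_step K) \<longrightarrow> arrs s' a = arrs ?s a))"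
  proof (rule wp_For[where I = ?I])
    fix i and s' :: state
    assume i: "i < n" and inv: "?I i s'" and x: "vars s' (vU K) = i"
      and fv: "\<And>y. y \<noteq> vU K \<Longrightarrow> y \<notin> wvars (label_step K) \<Longrightarrow> vars s' y = vars ?s y"
      and fa: "\<And>a. a \<notin> warrs (label_step K) \<Longrightarrow> arrs s' a = arrs ?s a"
    have "ready v s'" using s fv fa by (auto simp: ready_def writes)
    from wp_label_step[OF this x i inv]
    show "wp w (label_step K) s' (\<lambda>t s''. t \<le> 20 + 130 * n \<and>
      ?I (Suc i) (s''\<lparr>vars := (vars s'')(vU K := Suc i)\<rparr>))"
      by (elim wp_mono) auto
  qed (use s less_word in \<open>auto simp: writes ready_def map_replicate_const\<close>)
  show ?thesis
    unfolding label_prog_def wp_Seq wp_New n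
    by (rule wp_mono[OF loop]) (auto simp: writes algebra_simps)
qed

section \<open>The incidence matrix and its transpose\<close>

lemma wp_fill_row:
  assumes s: "ready v s" "vars s (vU K) = u" "u < n"
    and l: "arrs s (aLabel K) = map (label (outer_adj a v) n) [0..<n]"
    and B: "arrs s 0 = encode_matrix n B" "arrs s 1 = encode_matrix n (\<lambda>c x. B x c)"
  defines "B' \<equiv> \<lambda>x c. B x c \<or> a v x \<and> outside a v u \<and> a x u \<and> label (outer_adj a v) n u = c"
  shows "wp w (fill_row K) s (\<lambda>t s'. t \<le> 6 + 100 * n \<and>
    arrs s' 0 = encode_matrix n B' \<and> arrs s' 1 = encode_matrix n (\<lambda>c x. B' x c))"
proof -
  let ?c = "label (outer_adj a v) n u"
  let ?t = "\<lambda>x. a v x \<and> outside a v u \<and> a x u"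
  let ?M = "\<lambda>i x c. B x c \<or> (x < i \<and> ?t x \<and> ?c = c)"
  let ?I = "\<lambda>i (s' :: state). arrs s' 0 = encode_matrix n (?M i) \<and>
    arrs s' 1 = encode_matrix n (\<lambda>c x. ?M i x c)"
  let ?C = "Cond (Conj (Conj (Adj K (vV K) (vX K)) (Outside K (vU K))) (Adj K (vX K) (vU K)))
        (Seq (Store 0 (Entry K (Var (vX K)) (Read (aLabel K) (Var (vU K)))) (Const 1))
             (Store 1 (Entry K (Read (aLabel K) (Var (vU K))) (Var (vX K))) (Const 1))) Skip"
  have c: "?c < n" using label_less[OF s(3)] .
  have loop: "wp w (fill_row K) s (\<lambda>t s'. t \<le> 6 + n * (92 + 8) \<and> ?I n s' \<and>
     (\<forall>y. y \<noteq> vX K \<longrightarrow> y \<notin> wvars ?C \<longrightarrow> vars s' y = vars s y) \<and>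
     (\<forall>a. a \<notin> warrs ?C \<longrightarrow> arrs s' a = arrs s a))"
    unfolding fill_row_def
  proof (rule wp_For[where I = ?I])
    fix i and s' :: state
    assume i: "i < n" and inv: "?I i s'" and x: "vars s' (vX K) = i"
      and fv: "\<And>y. y \<noteq> vX K \<Longrightarrow> y \<notin> wvars ?C \<Longrightarrow> vars s' y = vars s y"
      and fa: "\<And>a. a \<notin> warrs ?C \<Longrightarrow> arrs s' a = arrs s a"
    have s': "ready v s'" "vars s' (vU K) = u" using s fv fa by (auto simp: ready_def)
    have l': "arrs s' (aLabel K) = map (label (outer_adj a v) n) [0..<n]" using l fa by simp
    have v: "vars s' (vV K) = v" "vars s' (vN K) = n" "v < n" using s' by (auto simp: ready_def)
    have test: "aval w (Conj (Conj (Adj K (vV K) (vX K)) (Outside K (vU K))) (Adj K (vX K) (vU K))) s'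
      = of_bool (?t i)"
      using s s' v x i by (auto simp: aval_Conj aval_Outside[OF s'(1)] aval_Adj[OF s'(1)])
    \<comment> \<open>For arbitrary \<open>r\<close>, because the second index is evaluated after
      the first store has already changed array 0.\<close>
    have e: "aval w (Entry K (Var (vX K)) (Read (aLabel K) (Var (vU K)))) r = i * n + ?c"
        "aval w (Entry K (Read (aLabel K) (Var (vU K))) (Var (vX K))) r = ?c * n + i"
      if "vars r = vars s'" "arrs r (aLabel K) = arrs s' (aLabel K)" for r
      using that s(3) s'(2) l' v x i c by (subst aval_Entry; simp)+
    have upd: "(encode_matrix n (?M i))[i * n + ?c := 1] = encode_matrix n (?M (Suc i))"
      "(encode_matrix n (\<lambda>c x. ?M i x c))[?c * n + i := 1] = encode_matrix n (\<lambda>c x. ?M (Suc i) x c)"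
      if "?t i"
      using that i c by (subst encode_matrix_update; auto simp: less_Suc_eq intro!: encode_matrix_cong)+
    have noupd: "encode_matrix n (?M i) = encode_matrix n (?M (Suc i))"
      "encode_matrix n (\<lambda>c x. ?M i x c) = encode_matrix n (\<lambda>c x. ?M (Suc i) x c)" if "\<not> ?t i"
      using that by (auto simp: less_Suc_eq intro!: encode_matrix_cong)
    show "wp w ?C s' (\<lambda>t s''. t \<le> 92 \<and> ?I (Suc i) (s''\<lparr>vars := (vars s'')(vX K := Suc i)\<rparr>))"
    proof (cases "?t i")
      case True
      then show ?thesis
        unfolding wp_Cond test using inv upd[OF True] w_pos by (simp add: wp_simps e)
    next
      case False
      then show ?thesis
        unfolding wp_Cond test using inv unfolding noupd[OF False] by (simp add: wp_simps)
    qed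
  qed (use s B less_word in \<open>auto simp: ready_def\<close>)
  have "encode_matrix n (?M n) = encode_matrix n B'"
    "encode_matrix n (\<lambda>c x. ?M n x c) = encode_matrix n (\<lambda>c x. B' x c)"
    by (auto simp: B'_def intro!: encode_matrix_cong)
  then show ?thesis
    by (intro wp_mono[OF loop]) auto
qed

text \<open>Each round adds the incidences witnessed by one \<open>u\<close>; starting from zero
  matrices, the rounds together realise the existential quantifier in \<open>sees\<close>.\<close>

lemma wp_fill_prog:
  assumes s: "ready v s"
    and l: "arrs s (aLabel K) = map (label (outer_adj a v) n) [0..<n]"
    and B: "arrs s 0 = replicate (n * n) 0" "arrs s 1 = replicate (n * n) 0"
  shows "wp w (fill_prog K) s (\<lambda>t s'. t \<le> 6 + 14 * n + 100 * (n * n) \<and>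
    arrs s' 0 = encode_matrix n (sees n a v) \<and>
    arrs s' 1 = encode_matrix n (\<lambda>c x. sees n a v x c) \<and>
    (\<forall>y. y \<noteq> vU K \<longrightarrow> y \<noteq> vX K \<longrightarrow> vars s' y = vars s y) \<and>
    (\<forall>b. b \<noteq> 0 \<longrightarrow> b \<noteq> 1 \<longrightarrow> arrs s' b = arrs s b))"
proof -
  let ?M = "\<lambda>i x c. \<exists>u<i. a v x \<and> outside a v u \<and> a x u \<and> label (outer_adj a v) n u = c"
  let ?I = "\<lambda>i (s' :: state). arrs s' 0 = encode_matrix n (?M i) \<and>
    arrs s' 1 = encode_matrix n (\<lambda>c x. ?M i x c)"
  have writes: "wvars (fill_row K) = {vX K}" "warrs (fill_row K) = {0, 1}"
    by (auto simp: fill_row_def)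
  have loop: "wp w (fill_prog K) s
    (\<lambda>t s'. t \<le> 6 + n * (6 + 100 * n + 8) \<and> ?I n s' \<and>
     (\<forall>y. y \<noteq> vU K \<longrightarrow> y \<notin> wvars (fill_row K) \<longrightarrow> vars s' y = vars s y) \<and>
     (\<forall>a. a \<notin> warrs (fill_row K) \<longrightarrow> arrs s' a = arrs s a))"
    unfolding fill_prog_def
  proof (rule wp_For[where I = ?I])
    fix i and s' :: state
    assume i: "i < n" and inv: "?I i s'" and x: "vars s' (vU K) = i"
      and fv: "\<And>y. y \<noteq> vU K \<Longrightarrow> y \<notin> wvars (fill_row K) \<Longrightarrow> vars s' y = vars s y"
      and fa: "\<And>a. a \<notin> warrs (fill_row K) \<Longrightarrow> arrs s' a = arrs s a"
    have r: "ready v s'" "arrs s' (aLabel K) = map (label (outer_adj a v) n) [0..<n]"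
      using s l fv fa by (auto simp: ready_def writes)
    have "(\<lambda>x c. ?M i x c \<or> a v x \<and> outside a v i \<and> a x i \<and> label (outer_adj a v) n i = c) = ?M (Suc i)"
      by (auto simp: fun_eq_iff less_Suc_eq)
    with wp_fill_row[OF r(1) x i r(2) conjunct1[OF inv] conjunct2[OF inv]]
    show "wp w (fill_row K) s' (\<lambda>t s''. t \<le> 6 + 100 * n \<and>
      ?I (Suc i) (s''\<lparr>vars := (vars s'')(vU K := Suc i)\<rparr>))"
      by (elim wp_mono) (auto simp: fun_eq_iff)
  qed (use s B less_word in \<open>auto simp: writes ready_def replicate_eq_encode_matrix\<close>)
  have "?M n = sees n a v" by (auto simp: sees_def fun_eq_iff)
  then show ?thesis
    by (intro wp_mono[OF loop]) (auto simp: writes algebra_simps fun_eq_iff)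
qed

section \<open>Testing the product at nonadjacent pairs of neighbours\<close>

lemma wp_check_row:
  assumes s: "ready v s" "vars s (vU K) = u" "u < n"
    and M: "arrs s 2 = encode_matrix n M" and f: "vars s (vFlag K) = of_bool p"
  shows "wp w (check_row K) s (\<lambda>t s'. t \<le> 6 + 110 * n \<and>
    vars s' (vFlag K) =
      of_bool (p \<and> (\<forall>x<n. a v u \<and> a v x \<and> u \<noteq> x \<and> \<not> a u x \<longrightarrow> M u x)))"
proof -
  let ?t = "\<lambda>x. a v u \<and> a v x \<and> u \<noteq> x \<and> \<not> a u x \<longrightarrow> M u x"
  let ?I = "\<lambda>i (s' :: state). vars s' (vFlag K) = of_bool (p \<and> (\<forall>x<i. ?t x))"
  let ?b = "Conj (Conj (Conj (Adj K (vV K) (vU K)) (Adj K (vV K) (vX K)))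
              (Neg (Bin Eq (Var (vU K)) (Var (vX K)))))
            (Conj (Neg (Adj K (vU K) (vX K))) (Neg (Read 2 (Entry K (Var (vU K)) (Var (vX K))))))"
  let ?C = "Cond ?b (Assign (vFlag K) (Const 0)) Skip"
  have loop: "wp w (check_row K) s (\<lambda>t s'. t \<le> 6 + n * (102 + 8) \<and> ?I n s' \<and>
     (\<forall>y. y \<noteq> vX K \<longrightarrow> y \<notin> wvars ?C \<longrightarrow> vars s' y = vars s y) \<and>
     (\<forall>a. a \<notin> warrs ?C \<longrightarrow> arrs s' a = arrs s a))"
    unfolding check_row_def
  proof (rule wp_For[where I = ?I])
    fix i and s' :: state
    assume i: "i < n" and inv: "?I i s'" and x: "vars s' (vX K) = i"
      and fv: "\<And>y. y \<noteq> vX K \<Longrightarrow> y \<notin> wvars ?C \<Longrightarrow> vars s' y = vars s y"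
      and fa: "\<And>a. a \<notin> warrs ?C \<Longrightarrow> arrs s' a = arrs s a"
    have s': "ready v s'" "vars s' (vU K) = u" "arrs s' 2 = encode_matrix n M"
      using s M fv fa by (auto simp: ready_def)
    have v: "vars s' (vV K) = v" "vars s' (vN K) = n" "v < n" using s' by (auto simp: ready_def)
    have e: "aval w (Read 2 (Entry K (Var (vU K)) (Var (vX K)))) s' = of_bool (M u i)"
      using aval_Entry[of s' "Var (vU K)" "Var (vX K)"] v s s' x i flat_index_less[OF s(3) i]
      by (simp add: nth_encode_matrix)
    have test: "aval w ?b s' = of_bool (\<not> ?t i)"
      unfolding aval_Conj aval_Neg e using s s' v x i w_pos
      by (auto simp: aval_Adj[OF s'(1)])
    show "wp w ?C s' (\<lambda>t s''. t \<le> 102 \<and> ?I (Suc i) (s''\<lparr>vars := (vars s'')(vX K := Suc i)\<rparr>))"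
    proof (cases "?t i")
      case True
      then have "(p \<and> (\<forall>x<i. ?t x)) = (p \<and> (\<forall>x<Suc i. ?t x))" by (auto simp: less_Suc_eq)
      with inv have "vars s' (vFlag K) = of_bool (p \<and> (\<forall>x<Suc i. ?t x))" by simp
      with True show ?thesis unfolding wp_Cond test by (simp add: wp_simps)
    next
      case False
      then have "\<not> (\<forall>x<Suc i. ?t x)" by blast
      with False show ?thesis
        unfolding wp_Cond test by (simp add: wp_simps)
    qed
  qed (use s f less_word in \<open>auto simp: ready_def\<close>)
  then show ?thesis
    by (elim wp_mono) auto
qed

lemma wp_check_prog:
  assumes s: "ready v s" and M: "arrs s 2 = encode_matrix n M"
  shows "wp w (check_prog K) s (\<lambda>t s'. t \<le> 8 + 14 * n + 110 * (n * n) \<and>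
    vars s' (vFlag K) =
      of_bool (\<forall>u<n. \<forall>x<n. a v u \<and> a v x \<and> u \<noteq> x \<and> \<not> a u x \<longrightarrow> M u x) \<and>
    (\<forall>y. y \<noteq> vU K \<longrightarrow> y \<noteq> vX K \<longrightarrow> y \<noteq> vFlag K \<longrightarrow> vars s' y = vars s y) \<and>
    arrs s' = arrs s)"
proof -
  let ?t = "\<lambda>u. \<forall>x<n. a v u \<and> a v x \<and> u \<noteq> x \<and> \<not> a u x \<longrightarrow> M u x"
  let ?I = "\<lambda>i (s' :: state). vars s' (vFlag K) = of_bool (\<forall>u<i. ?t u)"
  let ?s = "s\<lparr>vars := (vars s)(vFlag K := 1)\<rparr>"
  have writes: "wvars (check_row K) = {vX K, vFlag K}" "warrs (check_row K) = {}"
    by (auto simp: check_row_def)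
  have loop: "wp w (For (vU K) (vN K) (check_row K)) ?s
    (\<lambda>t s'. t \<le> 6 + n * (6 + 110 * n + 8) \<and> ?I n s' \<and>
     (\<forall>y. y \<noteq> vU K \<longrightarrow> y \<notin> wvars (check_row K) \<longrightarrow> vars s' y = vars ?s y) \<and>
     (\<forall>a. a \<notin> warrs (check_row K) \<longrightarrow> arrs s' a = arrs ?s a))"
  proof (rule wp_For[where I = ?I])
    fix i and s' :: state
    assume i: "i < n" and inv: "?I i s'" and x: "vars s' (vU K) = i"
      and fv: "\<And>y. y \<noteq> vU K \<Longrightarrow> y \<notin> wvars (check_row K) \<Longrightarrow> vars s' y = vars ?s y"
      and fa: "\<And>a. a \<notin> warrs (check_row K) \<Longrightarrow> arrs s' a = arrs ?s a"
    have r: "ready v s'" "arrs s' 2 = encode_matrix n M"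
      using s M fv fa by (auto simp: ready_def writes)
    have "((\<forall>u<i. ?t u) \<and> ?t i) = (\<forall>u<Suc i. ?t u)" by (auto simp: less_Suc_eq)
    with wp_check_row[OF r(1) x i r(2) inv]
    show "wp w (check_row K) s' (\<lambda>t s''. t \<le> 6 + 110 * n \<and>
      ?I (Suc i) (s''\<lparr>vars := (vars s'')(vU K := Suc i)\<rparr>))"
      by (elim wp_mono) simp
  qed (use s less_word in \<open>auto simp: writes ready_def\<close>)
  have one: "aval w (Const 1) s = 1" using w_pos by simp
  show ?thesis
    unfolding check_prog_def wp_Seq wp_Assign one
    by (rule wp_mono[OF loop]) (auto simp: writes algebra_simps)
qed

end

text \<open>One fixed \<open>n\<close> and word size at which \<open>P\<close> multiplies within
  \<open>tP\<close>. \<open>3 \<le> K\<close> puts the arrays 0, 1, 2 of its interface below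
  \<open>K\<close>, apart from the names of the surrounding program.\<close>

locale multiplication_run = instance_run +
  fixes P :: com and tP :: nat
  assumes K3: "3 \<le> K" and below: "com_below K P"
    and mult: "\<And>A B. \<exists>t s'.
      exec w P \<lparr>vars = (\<lambda>_. 0)(0 := n),
        arrs = (\<lambda>_. [])(0 := encode_matrix n A, 1 := encode_matrix n B)\<rparr> t s' \<and>
      t \<le> tP \<and> arrs s' 2 = encode_matrix n (matrix_product n A B)"
begin

lemma product_prog_unfold:
  assumes "vars s (vN K) = n"
  shows "wp w (product_prog K P) s Q \<longleftrightarrow>
    wp w (fill_prog K)
      (s\<lparr>vars := (\<lambda>x. if x < K then 0 else vars s x)(0 := n),
         arrs := (\<lambda>b. if b < K then [] else arrs s b)
           (0 := replicate (n * n) 0, 1 := replicate (n * n) 0)\<rparr>)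
      (\<lambda>t s'. wp w P s' (\<lambda>u s''. Q (11 + 4 * K + 2 * (n * n) + (t + u)) s''))"
proof -
  have "take_bit w (n * n) = n * n" using less_word by (simp add: take_bit_nat_eq_self)
  then show ?thesis
    using assms by (simp add: product_prog_def wp_simps wp_reset_prog numeral_eq_Suc algebra_simps)
qed

text \<open>After clearing and filling, the names below \<open>K\<close> look as in a regular call
  of \<open>P\<close>. So \<open>exec_agree\<close> supplies the run, and framing protects the names
  from \<open>K\<close> on.\<close>

lemma wp_product_prog:
  assumes s: "ready v s"
    and l: "arrs s (aLabel K) = map (label (outer_adj a v) n) [0..<n]"
  shows "wp w (product_prog K P) s (\<lambda>t s'. t \<le> 17 + 4 * K + 14 * n + 102 * (n * n) + tP \<and>
    arrs s' 2 = encode_matrix n (\<lambda>x y. \<exists>c<n. sees n a v x c \<and> sees n a v y c) \<and>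
    (\<forall>y. y \<ge> K \<longrightarrow> y \<noteq> vU K \<longrightarrow> y \<noteq> vX K \<longrightarrow> vars s' y = vars s y) \<and>
    (\<forall>b. b \<ge> K \<longrightarrow> arrs s' b = arrs s b))"
proof -
  have n: "vars s (vN K) = n" using s by (simp add: ready_def)
  let ?r = "s\<lparr>vars := (\<lambda>x. if x < K then 0 else vars s x)(0 := n),
         arrs := (\<lambda>b. if b < K then [] else arrs s b)
           (0 := replicate (n * n) 0, 1 := replicate (n * n) 0)\<rparr>"
  have r: "ready v ?r" "arrs ?r (aLabel K) = map (label (outer_adj a v) n) [0..<n]"
    "arrs ?r 0 = replicate (n * n) 0" "arrs ?r 1 = replicate (n * n) 0"
    using s l K3 by (auto simp: ready_def)
  show ?thesis
    unfolding product_prog_unfold[OF n]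
  proof (rule wp_mono[OF wp_fill_prog[OF r]])
    fix t and s1 :: state
    assume s1: "t \<le> 6 + 14 * n + 100 * (n * n) \<and>
      arrs s1 0 = encode_matrix n (sees n a v) \<and>
      arrs s1 1 = encode_matrix n (\<lambda>c x. sees n a v x c) \<and>
      (\<forall>y. y \<noteq> vU K \<longrightarrow> y \<noteq> vX K \<longrightarrow> vars s1 y = vars ?r y) \<and>
      (\<forall>b. b \<noteq> 0 \<longrightarrow> b \<noteq> 1 \<longrightarrow> arrs s1 b = arrs ?r b)"
    let ?i = "\<lparr>vars = (\<lambda>_. 0)(0 := n), arrs = (\<lambda>_. [])(0 := encode_matrix n (sees n a v),
      1 := encode_matrix n (\<lambda>c x. sees n a v x c))\<rparr> :: state"
    have "agree K ?i s1" using s1 by (auto simp: agree_def)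
    moreover obtain u s2 where u: "exec w P ?i u s2" "u \<le> tP"
      "arrs s2 2 = encode_matrix n (matrix_product n (sees n a v) (\<lambda>c x. sees n a v x c))"
      using mult by blast
    ultimately obtain s3 where s3: "exec w P s1 u s3" "agree K s2 s3"
      using exec_agree[OF u(1) below] by blast
    \<comment> \<open>An entry of \<open>B\<close> times its transpose says that two rows share a
      column, that is, a common component.\<close>
    have "arrs s3 2 = encode_matrix n (\<lambda>x y. \<exists>c<n. sees n a v x c \<and> sees n a v y c)"
      using u(3) s3(2) K3 by (simp add: agree_def matrix_product_def[abs_def])
    moreover have "vars s3 y = vars s1 y" "arrs s3 y = arrs s1 y" if "y \<ge> K" for y
      using exec_frame[OF s3(1), of y] com_below_wvars[OF below] com_below_warrs[OF below] that
      by (auto simp: subset_eq not_le[symmetric])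
    ultimately show "wp w P s1 (\<lambda>u s''.
      11 + 4 * K + 2 * (n * n) + (t + u) \<le> 17 + 4 * K + 14 * n + 102 * (n * n) + tP \<and>
      arrs s'' 2 = encode_matrix n (\<lambda>x y. \<exists>c<n. sees n a v x c \<and> sees n a v y c) \<and>
      (\<forall>y. y \<ge> K \<longrightarrow> y \<noteq> vU K \<longrightarrow> y \<noteq> vX K \<longrightarrow> vars s'' y = vars s y) \<and>
      (\<forall>b. b \<ge> K \<longrightarrow> arrs s'' b = arrs s b))"
      using s1 u(2) K3 by (intro wpI[OF s3(1)]) auto
  qed
qed

definition passes :: "nat \<Rightarrow> bool" where
  "passes v \<longleftrightarrow> (\<forall>x<n. \<forall>y<n. a v x \<and> a v y \<and> x \<noteq> y \<and> \<not> a x y \<longrightarrow>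
       (\<exists>c<n. sees n a v x c \<and> sees n a v y c))"

text \<open>Only the first \<open>vCount K\<close> entries are meaningful; the full length
  \<open>n\<close> leaves room for every vertex.\<close>

definition collected :: "nat list \<Rightarrow> state \<Rightarrow> bool" where
  "collected xs s \<longleftrightarrow> vars s (vCount K) = length xs \<and> length (arrs s (aRes K)) = n \<and>
     take (length xs) (arrs s (aRes K)) = xs"

text \<open>The time adds the bounds of labelling, product and check; the final conditional costs at
  most 9. \<open>length xs < n\<close> matters because a store out of bounds would be lost.\<close>

lemma wp_vertex_prog:
  assumes s: "ready v s" and c: "collected xs s" and xs: "length xs < n"
  shows "wp w (vertex_prog K P) s (\<lambda>t s'. t \<le> 50 + 4 * K + 58 * n + 342 * (n * n) + tP \<and>
    collected (if passes v then xs @ [v] else xs) s')"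
  unfolding vertex_prog_def wp_Seq
proof (rule wp_mono[OF wp_label_prog[OF s]], elim conjE, goal_cases)
  case (1 t1 s1)
  then have s1: "ready v s1" "collected xs s1" using s c by (auto simp: ready_def collected_def)
  show ?case
  proof (rule wp_mono[OF wp_product_prog[OF s1(1) 1(2)]], elim conjE, goal_cases)
    case p: (1 t2 s2)
    then have s2: "ready v s2" "collected xs s2" using s1 by (auto simp: ready_def collected_def)
    show ?case
    proof (rule wp_mono[OF wp_check_prog[OF s2(1) p(2)]], elim conjE, goal_cases)
      case q: (1 t3 s3)
      then have s3: "ready v s3" "collected xs s3" "vars s3 (vFlag K) = of_bool (passes v)"
        using s2 by (auto simp: ready_def collected_def passes_def)
      have word: "take_bit w (Suc (length xs)) = Suc (length xs)"
        using xs less_word[of "Suc (length xs)"] by (simp add: take_bit_nat_eq_self)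
      have snoc: "take (Suc (length xs)) ((arrs s3 (aRes K))[length xs := v]) = xs @ [v]"
        using s3(2) xs by (simp add: collected_def take_Suc_conv_app_nth)
      show ?case
        using 1(1) p(1) q(1) s3 word snoc w_pos
        by (auto simp: wp_simps collected_def ready_def)
    qed
  qed
qed

lemma wp_avoidable_prog:
  "wp w (avoidable_prog K P)
     \<lparr>vars = (\<lambda>_. 0)(0 := n), arrs = (\<lambda>_. [])(0 := encode_matrix n a)\<rparr>
     (\<lambda>t s'. t \<le> 50 + 100 * n + 20 * (n * n) + n * (50 + 4 * K + 58 * n + 342 * (n * n) + tP) \<and>
        arrs s' 1 = filter passes [0..<n])"
proof -
  let ?i = "\<lparr>vars = (\<lambda>_. 0)(0 := n), arrs = (\<lambda>_. [])(0 := encode_matrix n a)\<rparr> :: state"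
  let ?i' = "?i\<lparr>vars := (vars ?i)(vN K := n, vSquare K := n * n)\<rparr>"
  let ?T = "50 + 4 * K + 58 * n + 342 * (n * n) + tP"
  let ?xs = "\<lambda>i. filter passes [0..<i]"
  let ?I = "\<lambda>i. collected (?xs i)"
  let ?C = "vertex_prog K P"
  have n: "n < 2 ^ w" "n * n < 2 ^ w" using less_word by auto
  have writes: "vN K \<notin> wvars ?C" "vV K \<notin> wvars ?C" "aAdj K \<notin> warrs ?C"
    using com_below_wvars[OF below] com_below_warrs[OF below]
    by (auto simp: vertex_prog_def label_prog_def label_step_def mark_prog_def relabel_prog_def
        product_prog_def fill_prog_def fill_row_def check_prog_def check_row_def)
  \<comment> \<open>In round \<open>i < n\<close> at most \<open>i\<close> vertices are listed, so
    there is room for one more.\<close>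
  have len: "length (?xs i) \<le> i" for i
    using length_filter_le[of passes "[0..<i]"] by simp
  have loop: "wp w (For (vV K) (vN K) ?C) s
    (\<lambda>t s'. t \<le> 6 + n * (?T + 8) \<and> ?I n s' \<and>
     (\<forall>y. y \<noteq> vV K \<longrightarrow> y \<notin> wvars ?C \<longrightarrow> vars s' y = vars s y) \<and>
     (\<forall>a. a \<notin> warrs ?C \<longrightarrow> arrs s' a = arrs s a))"
    if s: "vars s (vN K) = n" "arrs s (aAdj K) = encode_matrix n a" "collected [] s" for s
  proof (rule wp_For[where I = ?I])
    fix i and s' :: state
    assume i: "i < n" and inv: "?I i s'" and x: "vars s' (vV K) = i"
      and fv: "\<And>y. y \<noteq> vV K \<Longrightarrow> y \<notin> wvars ?C \<Longrightarrow> vars s' y = vars s y"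
      and fa: "\<And>a. a \<notin> warrs ?C \<Longrightarrow> arrs s' a = arrs s a"
    have "ready i s'" using i x s fv[of "vN K"] fa[of "aAdj K"] writes by (simp add: ready_def)
    from wp_vertex_prog[OF this inv] len[of i] i
    show "wp w ?C s' (\<lambda>t s''. t \<le> ?T \<and> ?I (Suc i) (s''\<lparr>vars := (vars s'')(vV K := Suc i)\<rparr>))"
      by (auto simp: collected_def elim!: wp_mono)
  qed (use s n writes in \<open>auto simp: collected_def\<close>)
  have copy: "wp w (copy_array (vX K) (vSquare K) (aAdj K) 0) ?i' (\<lambda>t s'. t \<le> 8 + 13 * (n * n) \<and>
    arrs s' (aAdj K) = take (n * n) (arrs ?i' 0) \<and>
    (\<forall>y. y \<noteq> vX K \<longrightarrow> vars s' y = vars ?i' y) \<and> (\<forall>a. a \<noteq> aAdj K \<longrightarrow> arrs s' a = arrs ?i' a))"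
    by (rule wp_copy_array) (use n in auto)
  have unfold: "wp w (avoidable_prog K P) ?i Q \<longleftrightarrow>
    wp w (copy_array (vX K) (vSquare K) (aAdj K) 0) ?i' (\<lambda>t s1.
      wp w (Seq (New (aRes K) (Var (vN K)))
     (Seq (For (vV K) (vN K) (vertex_prog K P))
          (copy_array (vX K) (vCount K) 1 (aRes K)))) s1 (\<lambda>u s'. Q (6 + (t + u)) s'))" for Q
    using n by (simp add: avoidable_prog_def wp_Seq wp_Assign take_bit_nat_eq_self numeral_eq_Suc)
  show ?thesis
    unfolding unfold
  proof (rule wp_mono[OF copy], elim conjE, goal_cases)
    case (1 t1 s1)
    let ?s1 = "s1\<lparr>arrs := (arrs s1)(aRes K := replicate n 0)\<rparr>"
    have N: "aval w (Var (vN K)) s1 = n" using 1 by simp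
    \<comment> \<open>\<open>vCount K\<close> has not been assigned yet; its initial value 0
      represents the empty list.\<close>
    have s1: "vars ?s1 (vN K) = n" "arrs ?s1 (aAdj K) = encode_matrix n a" "collected [] ?s1"
      using 1 by (auto simp: collected_def)
    show ?case
      unfolding wp_Seq wp_New N
    proof (rule wp_mono[OF loop[OF s1]], elim conjE, goal_cases)
      case q: (1 t2 s2)
      have "length (?xs n) < 2 ^ w" using len[of n] n by linarith
      moreover have "vars s2 (vCount K) = length (?xs n)" "length (?xs n) \<le> length (arrs s2 (aRes K))"
        using q(2) len[of n] by (auto simp: collected_def)
      ultimately show ?case
        by (intro wp_mono[OF wp_copy_array[of s2 "vCount K" "length (?xs n)"]])
          (use 1(1) q(1,2) len[of n] in \<open>auto simp: collected_def algebra_simps\<close>)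
    qed
  qed
qed

end

theorem theorem25:
  fixes \<omega> :: real
  assumes "\<exists>P. multiplies_binary_matrices P (\<lambda>n. real n powr \<omega>)"
  shows "\<exists>P. lists_avoidable_vertices P (\<lambda>n. real n powr (1 + \<omega>))"
proof -
  obtain P where P: "multiplies_binary_matrices P (\<lambda>n. real n powr \<omega>)" using assms by blast
  then obtain k T where T: "(\<lambda>n. real (T n)) \<in> O(\<lambda>n. real n powr \<omega>)"
    and run: "\<And>n A B w. (n + 2) ^ k \<le> 2 ^ w \<Longrightarrow> \<exists>t s'.
      exec w P \<lparr>vars = (\<lambda>_. 0)(0 := n),
        arrs = (\<lambda>_. [])(0 := encode_matrix n A, 1 := encode_matrix n B)\<rparr> t s' \<and>
      t \<le> T n \<and> arrs s' 2 = encode_matrix n (matrix_product n A B)"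
    unfolding multiplies_binary_matrices_def runs_in_time_def by auto
  obtain K0 where "com_below K0 P" using ex_com_below by blast
  \<comment> \<open>All names of \<open>P\<close> and its interface names 0, 1, 2 are below
    \<open>K\<close>.\<close>
  define K where "K = K0 + 3"
  have K: "3 \<le> K" "com_below K P"
    using com_below_mono[OF \<open>com_below K0 P\<close>] by (auto simp: K_def)
  define T' where
    "T' n = 50 + 100 * n + 20 * (n * n) + n * (50 + 4 * K + 58 * n + 342 * (n * n) + T n)" for n
  have "(\<lambda>n. real (T' n)) \<in> O(\<lambda>n. real n powr (1 + \<omega>))"
  proof -
    \<comment> \<open>Hence \<open>1 + \<omega> \<ge> 3\<close>, and the cubic overhead is
      dominated.\<close>
    have \<omega>: "2 \<le> \<omega>" using matrix_multiplication_exponent_ge_2[OF P] .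
    have pow: "(\<lambda>n. c * real n ^ j) \<in> O(\<lambda>n. real n powr (1 + \<omega>))" if "j \<le> 3" for c j
    proof -
      \<comment> \<open>Only from \<open>n = 1\<close> on: at 0 the right side is 0, but
        \<open>0 ^ 0 = 1\<close>.\<close>
      have "eventually (\<lambda>n. real n ^ j \<le> real n powr (1 + \<omega>)) at_top"
        using eventually_ge_at_top[of 1]
      proof eventually_elim
        case (elim n)
        then have "real n ^ j = real n powr real j" by (simp add: powr_realpow)
        also have "\<dots> \<le> real n powr (1 + \<omega>)"
          using elim \<omega> that by (intro powr_mono) auto
        finally show ?case .
      qed
      then have "(\<lambda>n. real n ^ j) \<in> O(\<lambda>n. real n powr (1 + \<omega>))"
        by (intro bigoI[of _ 1]) (auto elim: eventually_mono)
      then show ?thesis by (cases "c = 0") simp_all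
    qed
    have nT: "(\<lambda>n. real n * real (T n)) \<in> O(\<lambda>n. real n powr (1 + \<omega>))"
    proof -
      have "(\<lambda>n. real n * real (T n)) \<in> O(\<lambda>n. real n * real n powr \<omega>)"
        using T by (intro landau_o.big.mult) auto
      then show ?thesis by (simp add: powr_mult_base)
    qed
    have eq: "real (T' n) = 50 * real n ^ 0 + (150 + 4 * K) * real n ^ 1 + 78 * real n ^ 2
      + 342 * real n ^ 3 + real n * real (T n)" for n
      by (simp add: T'_def algebra_simps power2_eq_square power3_eq_cube)
    show ?thesis
      unfolding eq by (intro sum_in_bigo pow nT) auto
  qed
  moreover have "\<exists>t s'. exec w (avoidable_prog K P)
      \<lparr>vars = (\<lambda>_. 0)(0 := n), arrs = (\<lambda>_. [])(0 := encode_matrix n (\<lambda>i j. {i, j} \<in> E))\<rparr> t s' \<and>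
      t \<le> T' n \<and> distinct (arrs s' 1) \<and> set (arrs s' 1) = {v. avoidable {..<n} E v}"
    if G: "simple_graph {..<n} E" and w: "(n + 2) ^ (k + 2) \<le> 2 ^ w" for n E w
  proof -
    \<comment> \<open>The exponent \<open>k\<close> is what \<open>P\<close> requires of the word
      size; the extra 2 gives \<open>(n + 2) ^ 2 \<le> 2 ^ w\<close>, enough for all indices of the
      surrounding program.\<close>
    have "(n + 2) ^ k \<le> (n + 2) ^ (k + 2)" "(n + 2) ^ 2 \<le> (n + 2) ^ (k + 2)"
      by (intro power_increasing; simp)+
    then have w': "(n + 2) ^ k \<le> 2 ^ w" "(n + 2) ^ 2 \<le> 2 ^ w" using w by linarith+
    have fits: "n * n + n < 2 ^ w" using w'(2) by (simp add: power2_eq_square)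
    have w_pos: "0 < w" using w'(2) by (cases w) (auto simp: power2_eq_square)
    interpret multiplication_run K n w "\<lambda>i j. {i, j} \<in> E" P "T n"
      by unfold_locales (use fits w_pos K run[OF w'(1)] in auto)
    have "passes v \<longleftrightarrow> avoidable {..<n} E v" if "v < n" for v
      using avoidable_iff_sees[OF G that] by (simp add: passes_def)
    then have "set (filter passes [0..<n]) = {v. avoidable {..<n} E v}"
      by (auto simp: avoidable_def)
    then show ?thesis
      using wp_avoidable_prog unfolding wp_def T'_def by (metis distinct_filter distinct_upt)
  qed
  ultimately show ?thesis
    unfolding lists_avoidable_vertices_def runs_in_time_def
    by (intro exI[of _ "avoidable_prog K P"] exI[of _ "k + 2"] exI[of _ T']) auto
qed

end
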